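(* Let $\mathbf{a}=\{a_1,\dots,a_n\}$ and $\mathbf{b}=\{b_1,\dots,b_n\}$ be disjoint subsets of the unit disk $\mathbb{D}$ with $n$ elements each, and let $B_{\mathbf{a}}$ be the finite Blaschke product with simple zeros $\mathbf{a}$. Suppose that the points $b_j$ are arranged so that the numbers $|B_{\mathbf{a}}(b_j)|$, $1\le j\le n$, are in decreasing order. Let $s_k(P_{\mathcal{Z}^0_{\mathbf{a}}}P_{\mathcal{Z}^0_{\mathbf{b}}})$, $0\le k\le n-1$, denote the singular values of $P_{\mathcal{Z}^0_{\mathbf{a}}}P_{\mathcal{Z}^0_{\mathbf{b}}}$, also arranged in decreasing order. Then: 1. $$\prod_{j=1}^m|B_{\mathbf{a}}(b_j)|\le\prod_{j=1}^m\sqrt{1-s_{n-j}^2(P_{\mathcal{Z}^0_{\mathbf{a}}}P_{\mathcal{Z}^0_{\mathbf{b}}})}$$ for $1\le m\le n$, with equality for $m=n$. 2. $$\sum_{j=1}^m|B_{\mathbf{a}}(b_j)|\le\sum_{j=1}^m\sqrt{1-s_{n-j}^2(P_{\mathcal{Z}^0_{\mathbf{a}}}P_{\mathcal{Z}^0_{\mathbf{b}}})}$$ for $1\le m\le n$.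
   Context: $H^2$ is the Hardy space of the disk, with Szegő kernels $k_w(z)=\frac1{1-\bar wz}$. $B_{\mathbf{a}}=\prod_{j=1}^n b_{a_j}$, where $b_0(z)=z$ and $b_{a}(z)=\frac{\bar a}{|a|}\frac{a-z}{1-\bar az}$ for $a\ne0$. $\mathcal{H}_0$ is the $2n$-dimensional span of $\{k_{a_i},k_{b_j}:1\le i,j\le n\}$ in $H^2$; $\mathcal{Z}^0_{\mathbf{a}}$ (resp. $\mathcal{Z}^0_{\mathbf{b}}$) is the $n$-dimensional subspace of functions in $\mathcal{H}_0$ vanishing on $\mathbf{a}$ (resp. $\mathbf{b}$), and $P_{\mathcal{S}}$ is the orthogonal projection onto $\mathcal{S}$. The singular values $s_0\ge\dots\ge s_{n-1}$ of $P_{\mathcal{Z}^0_{\mathbf{a}}}P_{\mathcal{Z}^0_{\mathbf{b}}}$ are those of it as an operator from $\mathcal{Z}^0_{\mathbf{b}}$ to $\mathcal{Z}^0_{\mathbf{a}}$ (equivalently its $n$ largest singular values on $\mathcal{H}_0$). *)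

theory Defs
  imports "HOL-Complex_Analysis.Complex_Analysis" "HOL-Library.Function_Algebras"
    "HOL-Library.Multiset"
begin

text \<open>The complex vector space of complex-valued functions on a set; \<open>cfun.span\<close> and
  \<open>cfun.dim\<close> are the complex-linear span and dimension.\<close>

global_interpretation cfun: vector_space "\<lambda>(c::complex) (f::'a \<Rightarrow> complex) x. c * f x"
  by unfold_locales (auto simp: fun_eq_iff algebra_simps)


text \<open>Functions on the unit disk are represented as functions on \<open>\<complex>\<close> that are \<open>0\<close>
  outside the disk, so that equality of elements of \<open>H\<^sup>2\<close> is equality on the disk.\<close>

definition taylor_coeff :: "(complex \<Rightarrow> complex) \<Rightarrow> nat \<Rightarrow> complex" where
  "taylor_coeff f n = (deriv ^^ n) f 0 / fact n"

definition hardy_space :: "(complex \<Rightarrow> complex) set" where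
  "hardy_space = {f. f holomorphic_on ball 0 1 \<and> (\<forall>z. z \<notin> ball 0 1 \<longrightarrow> f z = 0) \<and>
     summable (\<lambda>n. (cmod (taylor_coeff f n))\<^sup>2)}"

definition hardy_inner :: "(complex \<Rightarrow> complex) \<Rightarrow> (complex \<Rightarrow> complex) \<Rightarrow> complex" where
  "hardy_inner f g = (\<Sum>n. taylor_coeff f n * cnj (taylor_coeff g n))"

definition szego_kernel :: "complex \<Rightarrow> complex \<Rightarrow> complex" where
  "szego_kernel w z = (if z \<in> ball 0 1 then 1 / (1 - cnj w * z) else 0)"

definition blaschke_factor :: "complex \<Rightarrow> complex \<Rightarrow> complex" where
  "blaschke_factor a z =
     (if a = 0 then z else cnj a / of_real (cmod a) * ((a - z) / (1 - cnj a * z)))"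

definition blaschke_product :: "complex set \<Rightarrow> complex \<Rightarrow> complex" where
  "blaschke_product A z = (\<Prod>a\<in>A. blaschke_factor a z)"


definition kernel_span :: "complex set \<Rightarrow> (complex \<Rightarrow> complex) set" where
  "kernel_span S = cfun.span (szego_kernel ` S)"

definition vanishing_subspace :: "complex set \<Rightarrow> complex set \<Rightarrow> (complex \<Rightarrow> complex) set" where
  "vanishing_subspace S A = {f \<in> kernel_span S. \<forall>a\<in>A. f a = 0}"

definition orth_proj ::
    "(complex \<Rightarrow> complex) set \<Rightarrow> (complex \<Rightarrow> complex) \<Rightarrow> (complex \<Rightarrow> complex)" where
  "orth_proj V f = (THE g. g \<in> V \<and> (\<forall>h\<in>V. hardy_inner (f - g) h = 0))"


text \<open>In the following, \<open>T\<close> is a linear operator from a finite-dimensional subspace \<open>V\<close> of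
  \<open>H\<^sup>2\<close> to another one, \<open>W\<close>. The codomain is not an argument: the adjoint at \<open>g \<in> W\<close>
  is determined by \<open>V\<close>, \<open>T\<close> and \<open>g\<close>.\<close>

definition hardy_adjoint ::
    "(complex \<Rightarrow> complex) set \<Rightarrow> ((complex \<Rightarrow> complex) \<Rightarrow> (complex \<Rightarrow> complex)) \<Rightarrow>
     (complex \<Rightarrow> complex) \<Rightarrow> (complex \<Rightarrow> complex)" where
  "hardy_adjoint V T g = (THE h. h \<in> V \<and> (\<forall>f\<in>V. hardy_inner (T f) g = hardy_inner f h))"

definition singular_space ::
    "(complex \<Rightarrow> complex) set \<Rightarrow> ((complex \<Rightarrow> complex) \<Rightarrow> (complex \<Rightarrow> complex)) \<Rightarrow>
     real \<Rightarrow> (complex \<Rightarrow> complex) set" where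
  "singular_space V T s =
     {f \<in> V. hardy_adjoint V T (T f) = (\<lambda>z. complex_of_real (s\<^sup>2) * f z)}"

text \<open>Singular values are the nonnegative square roots of the eigenvalues of \<open>T\<^sup>* T\<close> on \<open>V\<close>,
  each repeated according to the dimension of its eigenspace.\<close>

definition singular_values ::
    "(complex \<Rightarrow> complex) set \<Rightarrow> ((complex \<Rightarrow> complex) \<Rightarrow> (complex \<Rightarrow> complex)) \<Rightarrow>
     real multiset" where
  "singular_values V T =
     (\<Sum>s\<in>{s. 0 \<le> s \<and> (\<exists>f\<in>singular_space V T s. f \<noteq> 0)}.
        replicate_mset (cfun.dim (singular_space V T s)) s)"

text \<open>The \<open>k\<close>-th singular value, counted from \<open>0\<close>, in decreasing order.\<close>

definition singular_value ::
    "(complex \<Rightarrow> complex) set \<Rightarrow> ((complex \<Rightarrow> complex) \<Rightarrow> (complex \<Rightarrow> complex)) \<Rightarrow>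
     nat \<Rightarrow> real" where
  "singular_value V T k = rev (sorted_list_of_multiset (singular_values V T)) ! k"


lemma hardy_space_subspace: "cfun.subspace hardy_space"
proof (rule cfun.subspaceI)
  show "0 \<in> hardy_space"
  proof -
    have "(\<lambda>_. 0) \<in> hardy_space" by (simp add: hardy_space_def taylor_coeff_def)
    thus ?thesis by (simp add: zero_fun_def)
  qed
next
  fix f g assume f: "f \<in> hardy_space" and g: "g \<in> hardy_space"
  have fg: "f + g = (\<lambda>z. f z + g z)" by (simp add: fun_eq_iff)
  have c: "taylor_coeff (f + g) n = taylor_coeff f n + taylor_coeff g n" for n
    using f g unfolding fg hardy_space_def taylor_coeff_def
    by (subst higher_deriv_add[of _ "ball 0 1"]) (auto simp: add_divide_distrib)
  have le: "(cmod (a + b))\<^sup>2 \<le> 2 * (cmod a)\<^sup>2 + 2 * (cmod b)\<^sup>2" for a b :: complex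
  proof -
    have "(cmod (a + b))\<^sup>2 \<le> (cmod a + cmod b)\<^sup>2"
      by (intro power_mono norm_triangle_ineq) auto
    also have "\<dots> \<le> 2 * (cmod a)\<^sup>2 + 2 * (cmod b)\<^sup>2"
      using zero_le_power2[of "cmod a - cmod b"] by (simp add: power2_eq_square algebra_simps)
    finally show ?thesis .
  qed
  have "summable (\<lambda>n. 2 * (cmod (taylor_coeff f n))\<^sup>2 + 2 * (cmod (taylor_coeff g n))\<^sup>2)"
    using f g by (intro summable_add summable_mult) (auto simp: hardy_space_def)
  hence "summable (\<lambda>n. (cmod (taylor_coeff (f + g) n))\<^sup>2)"
    unfolding c by (rule summable_comparison_test') (use le in auto)
  thus "f + g \<in> hardy_space"
    using f g by (auto simp: hardy_space_def fg intro!: holomorphic_intros)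
next
  fix c f assume f: "f \<in> hardy_space"
  have "taylor_coeff (\<lambda>z. c * f z) n = c * taylor_coeff f n" for n
    using f unfolding hardy_space_def taylor_coeff_def
    by (subst higher_deriv_cmult[of _ "ball 0 1"]) auto
  thus "(\<lambda>z. c * f z) \<in> hardy_space"
    using f by (auto simp: hardy_space_def norm_mult power_mult_distrib
        intro!: holomorphic_intros summable_mult)
qed

lemma taylor_coeff_szego_kernel:
  assumes "w \<in> ball 0 1"
  shows "taylor_coeff (szego_kernel w) n = cnj w ^ n"
proof -
  have "(\<lambda>n. fps_nth (Abs_fps (\<lambda>n. cnj w ^ n)) n * z ^ n) sums szego_kernel w z"
    if "z \<in> ball 0 1" for z
  proof -
    have "cmod (cnj w * z) < 1"
      using assms that mult_strict_mono'[of "cmod w" 1 "cmod z" 1] by (simp add: norm_mult)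
    from geometric_sums[OF this] show ?thesis
      using that by (simp add: szego_kernel_def power_mult_distrib)
  qed
  moreover have "eventually (\<lambda>z. z \<in> ball (0::complex) 1) (nhds 0)"
    by (intro eventually_nhds_in_open) auto
  ultimately have "szego_kernel w has_fps_expansion Abs_fps (\<lambda>n. cnj w ^ n)"
    by (intro has_fps_expansionI) (auto elim!: eventually_mono)
  from fps_nth_fps_expansion[OF this, of n] show ?thesis
    by (simp add: taylor_coeff_def)
qed

lemma szego_kernel_in_hardy_space:
  assumes "w \<in> ball 0 1"
  shows "szego_kernel w \<in> hardy_space"
proof -
  have nz: "1 - cnj w * z \<noteq> 0" if "z \<in> ball 0 1" for z
  proof
    assume "1 - cnj w * z = 0"
    hence "cmod (cnj w * z) = 1" by (metis eq_iff_diff_eq_0 norm_one)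
    moreover have "cmod (cnj w * z) < 1"
      using assms that mult_strict_mono'[of "cmod w" 1 "cmod z" 1] by (simp add: norm_mult)
    ultimately show False by simp
  qed
  have "(\<lambda>z. 1 / (1 - cnj w * z)) holomorphic_on ball 0 1"
    using nz by (auto intro!: holomorphic_intros)
  hence "szego_kernel w holomorphic_on ball 0 1"
    by (rule holomorphic_transform) (simp add: szego_kernel_def)
  moreover have "summable (\<lambda>n. ((cmod w)\<^sup>2) ^ n)"
    using assms by (intro summable_geometric) (simp add: abs_square_less_1)
  ultimately show ?thesis
    using assms by (auto simp: hardy_space_def taylor_coeff_szego_kernel szego_kernel_def
        norm_power power_mult[symmetric] mult.commute)
qed

lemma kernel_span_subset_hardy_space:
  assumes "S \<subseteq> ball 0 1"
  shows "kernel_span S \<subseteq> hardy_space"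
  unfolding kernel_span_def
  using assms szego_kernel_in_hardy_space hardy_space_subspace by (intro cfun.span_minimal) auto

lemma szego_kernel_reproducing:
  assumes "f \<in> hardy_space" "w \<in> ball 0 1"
  shows "hardy_inner f (szego_kernel w) = f w"
proof -
  have "(\<lambda>n. taylor_coeff f n * w ^ n) sums f w"
    using holomorphic_power_series[of f 0 1 w] assms
    by (simp add: hardy_space_def taylor_coeff_def)
  thus ?thesis
    using assms(2) by (simp add: hardy_inner_def taylor_coeff_szego_kernel sums_iff)
qed

end

theory Submission
  imports Defs "Jordan_Normal_Form.Determinant"
    "HOL-Computational_Algebra.Fundamental_Theorem_Algebra"
begin

text \<open>Let \<open>K\<^sub>B\<close> be the span of the kernels at \<open>B\<close>, and let \<open>P\<close> and \<open>Q\<close> be the projections to the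
  functions vanishing on \<open>A\<close> and on \<open>B\<close>. Since \<open>k\<^sub>w\<close> minus \<open>B\<^sub>A k\<^sub>w\<close> times the conjugate of
  \<open>B\<^sub>A(w)\<close> is in the span of the kernels at \<open>A\<close>, we know \<open>P k\<^sub>w\<close>, and the
  compression \<open>(1 - Q) P\<close> of \<open>P\<close> to \<open>K\<^sub>B\<close> has the form matrix \<open>D\<^sup>* G D\<close> in the basis of kernels, where
  \<open>G\<close> is their Gram matrix and \<open>D\<close> is the diagonal matrix of the values \<open>B\<^sub>A(b\<^sub>j)\<close>. Comparing with an
  orthonormal eigenbasis, with eigenvalues \<open>\<nu>\<^sub>j\<close>, Weyl's inequality bounds the products of the
  \<open>|B\<^sub>A(b\<^sub>j)|\<^sup>2\<close> by those of the \<open>\<nu>\<^sub>j\<close>. The map \<open>Q P\<close> carries this eigenbasis to an orthogonal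
  eigenbasis of \<open>Q P\<close> on the functions vanishing on \<open>B\<close>, with eigenvalues \<open>1 - \<nu>\<^sub>j\<close>, so these are
  the squared singular values.\<close>

section \<open>Weyl's inequality\<close>

text \<open>Induction on the size of \<open>S\<close>: its largest element \<open>M\<close> is at
  least \<open>card S - 1\<close>, so \<open>w M\<close> is bounded by the last factor of the
  initial product.\<close>

lemma prod_antimono_le_initial:
  fixes w :: "nat \<Rightarrow> real"
  assumes "\<And>i j. i \<le> j \<Longrightarrow> j < n \<Longrightarrow> w j \<le> w i" "\<And>i. i < n \<Longrightarrow> 0 \<le> w i"
    and "S \<subseteq> {..<n}"
  shows "prod w S \<le> prod w {..<card S}"
  using assms(3)
proof (induction "card S" arbitrary: S)
  case 0
  then have "S = {}" using finite_subset by fastforce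
  then show ?case by simp
next
  case (Suc m)
  have fin: "finite S" using Suc.prems finite_subset by blast
  define M where "M = Max S"
  have "S \<noteq> {}" using Suc.hyps(2) by auto
  then have M: "M \<in> S" using fin by (simp add: M_def)
  have "S \<subseteq> {..M}" using fin by (auto simp: M_def)
  then have "Suc m \<le> Suc M" using card_mono[of "{..M}" S] Suc.hyps(2) by simp
  then have mM: "w M \<le> w m" using assms(1)[of m M] M Suc.prems by auto
  have c: "card (S - {M}) = m" using Suc.hyps(2) M fin by simp
  have "prod w S = w M * prod w (S - {M})" using fin M by (rule prod.remove)
  also have "\<dots> \<le> w m * prod w {..<m}"
  proof (rule mult_mono)
    show "prod w (S - {M}) \<le> prod w {..<m}"
      using Suc.hyps(1)[of "S - {M}"] c Suc.prems by auto
    show "0 \<le> w m" using mM assms(2)[of M] M Suc.prems by (auto intro: order_trans)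
    show "0 \<le> prod w (S - {M})" using Suc.prems assms(2) by (intro prod_nonneg) auto
  qed (rule mM)
  finally show ?case using Suc.hyps(2)[symmetric] by (simp add: mult.commute)
qed

text \<open>The Cauchy--Binet formula, summed over all maps instead of over the increasing ones:
  this makes it a rearrangement of the Leibniz formula.\<close>

lemma det_weighted_gram:
  fixes x :: "nat \<Rightarrow> nat \<Rightarrow> complex" and w :: "nat \<Rightarrow> real"
  shows "fact m * det (mat m m (\<lambda>(i, j). \<Sum>k<n. w k * x i k * cnj (x j k))) =
    of_real (\<Sum>f\<in>{0..<m} \<rightarrow>\<^sub>E {..<n}. (\<Prod>i=0..<m. w (f i)) *
        (cmod (det (mat m m (\<lambda>(i, j). x j (f i)))))\<^sup>2)"
proof -
  define P where "P = {p. p permutes {0..<m}}"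
  define M where "M = mat m m (\<lambda>(i, j). \<Sum>k<n. w k * x i k * cnj (x j k))"
  define X where "X f = mat m m (\<lambda>(i, j). x j (f i))" for f
  have finP: "finite P" by (simp add: P_def finite_permutations)
  have lt: "p i < m" if "p \<in> P" "i \<in> {0..<m}" for p i
    using that permutes_in_image[of p "{0..<m}" i] by (simp add: P_def)
  have detX: "det (X f) = (\<Sum>p\<in>P. signof p * (\<Prod>i=0..<m. x (p i) (f i)))" for f
    unfolding P_def X_def
    by (subst det_def'[of _ m]) (auto intro!: sum.cong prod.cong lt simp: P_def)
  have expand: "of_real ((\<Prod>i=0..<m. w (f i)) * (cmod (det (X f)))\<^sup>2) =
      (\<Sum>p\<in>P. \<Sum>q\<in>P. signof p * signof q *
         (\<Prod>i=0..<m. w (f i) * x (p i) (f i) * cnj (x (q i) (f i))))" for f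
  proof -
    have "of_real ((\<Prod>i=0..<m. w (f i)) * (cmod (det (X f)))\<^sup>2) =
       (\<Prod>i=0..<m. complex_of_real (w (f i))) * (det (X f) * cnj (det (X f)))"
      by (simp add: complex_norm_square del: of_real_power)
    also have "det (X f) * cnj (det (X f)) =
      (\<Sum>p\<in>P. \<Sum>q\<in>P. signof p * (\<Prod>i=0..<m. x (p i) (f i)) *
         (signof q * (\<Prod>i=0..<m. cnj (x (q i) (f i)))))"
      by (simp add: detX sum_product)
    finally show ?thesis
      by (simp add: sum_distrib_left prod.distrib mult_ac)
  qed
  have "of_real (\<Sum>f\<in>{0..<m} \<rightarrow>\<^sub>E {..<n}. (\<Prod>i=0..<m. w (f i)) * (cmod (det (X f)))\<^sup>2) =
     (\<Sum>f\<in>{0..<m} \<rightarrow>\<^sub>E {..<n}. \<Sum>p\<in>P. \<Sum>q\<in>P. signof p * signof q *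
         (\<Prod>i=0..<m. w (f i) * x (p i) (f i) * cnj (x (q i) (f i))))"
    unfolding of_real_sum by (rule sum.cong[OF refl expand])
  \<comment> \<open>With the sum over the maps \<open>f\<close> innermost, it factors into a product
    over \<open>i\<close> of sums over \<open>k\<close>.\<close>
  also have "\<dots> = (\<Sum>p\<in>P. \<Sum>q\<in>P. \<Sum>f\<in>{0..<m} \<rightarrow>\<^sub>E {..<n}. signof p * signof q *
         (\<Prod>i=0..<m. w (f i) * x (p i) (f i) * cnj (x (q i) (f i))))"
    by (subst sum.swap) (rule sum.cong[OF refl sum.swap])
  also have "\<dots> = (\<Sum>p\<in>P. \<Sum>q\<in>P. signof p * signof q *
         (\<Prod>i=0..<m. \<Sum>k<n. w k * x (p i) k * cnj (x (q i) k)))"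
    by (simp add: prod_sum_PiE sum_distrib_left)
  also have "\<dots> = (\<Sum>p\<in>P. \<Sum>q\<in>P. signof p * signof q * (\<Prod>i=0..<m. M $$ (p i, q i)))"
    by (intro sum.cong refl arg_cong2[where f = "(*)"] prod.cong) (auto simp: M_def lt)
  \<comment> \<open>For fixed \<open>p\<close>, the sum over \<open>q\<close> is the determinant of
    \<open>M\<close> with its rows permuted by \<open>p\<close>. This is
    \<open>signof p * det M\<close>, so the signs cancel and each of the \<open>fact m\<close>
    permutations contributes \<open>det M\<close>.\<close>
  also have "\<dots> = (\<Sum>p\<in>P. signof p * det (mat m m (\<lambda>(i, j). M $$ (p i, j))))"
    unfolding P_def
    by (subst det_def'[of _ m])
       (auto intro!: sum.cong prod.cong lt simp: P_def sum_distrib_left mult.assoc)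
  also have "\<dots> = (\<Sum>p\<in>P. det M)"
  proof (rule sum.cong[OF refl])
    fix p assume "p \<in> P"
    then have "det (mat m m (\<lambda>(i, j). M $$ (p i, j))) = signof p * det M"
      by (intro det_permute_rows) (auto simp: M_def P_def)
    then show "signof p * det (mat m m (\<lambda>(i, j). M $$ (p i, j))) = det M"
      by (simp add: sign_def)
  qed
  also have "\<dots> = fact m * det M"
    using card_permutations[of "{0..<m}" m] by (simp add: P_def)
  finally show ?thesis by (simp add: M_def X_def)
qed

text \<open>Every Leibniz term contains each row factor and each column factor exactly once.\<close>

lemma det_scaled_rows_cols:
  fixes M :: "nat \<Rightarrow> nat \<Rightarrow> 'a::comm_ring_1"
  shows "det (mat m m (\<lambda>(i, j). c i * d j * M i j)) =
     (\<Prod>i<m. c i) * (\<Prod>i<m. d i) * det (mat m m (\<lambda>(i, j). M i j))"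
proof -
  have *: "(\<Prod>i=0..<m. mat m m (\<lambda>(i, j). c i * d j * M i j) $$ (i, p i)) =
     (\<Prod>i<m. c i) * (\<Prod>i<m. d i) * (\<Prod>i=0..<m. mat m m (\<lambda>(i, j). M i j) $$ (i, p i))"
    if p: "p permutes {0..<m}" for p
  proof -
    have "(\<Prod>i=0..<m. mat m m (\<lambda>(i, j). c i * d j * M i j) $$ (i, p i)) =
       (\<Prod>i=0..<m. c i * d (p i) * mat m m (\<lambda>(i, j). M i j) $$ (i, p i))"
      using permutes_in_image[OF p] by (intro prod.cong) auto
    moreover have "(\<Prod>i=0..<m. d (p i)) = (\<Prod>i=0..<m. d i)"
      using prod.permute[OF p, of d] by (simp add: o_def)
    ultimately show ?thesis by (simp add: prod.distrib atLeast0LessThan)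
  qed
  show ?thesis
    unfolding det_def'[of "mat m m F" m for F, OF mat_carrier] sum_distrib_left
  proof (rule sum.cong[OF refl])
    fix p assume "p \<in> {p. p permutes {0..<m}}"
    then have p: "p permutes {0..<m}" by simp
    show "signof p * (\<Prod>i=0..<m. mat m m (\<lambda>(i, j). c i * d j * M i j) $$ (i, p i)) =
      (\<Prod>i<m. c i) * (\<Prod>i<m. d i) *
        (signof p * (\<Prod>i=0..<m. mat m m (\<lambda>(i, j). M i j) $$ (i, p i)))"
      unfolding *[OF p] by (simp only: mult_ac)
  qed
qed

text \<open>Weyl's inequality between the eigenvalues \<open>l\<close> and the squared singular values \<open>w\<close> of an
  operator; the rows of \<open>x\<close> are the coordinates of the eigenvectors in a basis of
  singular vectors.\<close>

lemma weyl_product: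
  fixes x :: "nat \<Rightarrow> nat \<Rightarrow> complex" and w :: "nat \<Rightarrow> real" and l :: "nat \<Rightarrow> complex" and m n :: nat
  defines "G \<equiv> \<lambda>i j. \<Sum>k<n. x i k * cnj (x j k)"
  assumes anti: "\<And>i j. i \<le> j \<Longrightarrow> j < n \<Longrightarrow> w j \<le> w i" and nonneg: "\<And>i. i < n \<Longrightarrow> 0 \<le> w i"
    and eq: "\<And>i j. i < m \<Longrightarrow> j < m \<Longrightarrow>
      (\<Sum>k<n. w k * x i k * cnj (x j k)) = cnj (l i) * l j * G i j"
    and det: "det (mat m m (\<lambda>(i, j). G i j)) \<noteq> 0"
  shows "(\<Prod>i<m. (cmod (l i))\<^sup>2) \<le> (\<Prod>i<m. w i)"
    and "m = n \<Longrightarrow> (\<Prod>i<m. (cmod (l i))\<^sup>2) = (\<Prod>i<m. w i)"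
proof -
  define F where "F = {0..<m} \<rightarrow>\<^sub>E {..<n}"
  define h where "h f = (cmod (det (mat m m (\<lambda>(i, j). x j (f i)))))\<^sup>2" for f
  have G1: "fact m * det (mat m m (\<lambda>(i, j). G i j)) = of_real (\<Sum>f\<in>F. h f)"
    using det_weighted_gram[where m = m and n = n and w = "\<lambda>_. 1" and x = x] by (simp add: G_def F_def h_def)
  have "det (mat m m (\<lambda>(i, j). \<Sum>k<n. w k * x i k * cnj (x j k))) =
      det (mat m m (\<lambda>(i, j). cnj (l i) * l j * G i j))"
    by (intro arg_cong[where f = det]) (auto simp: eq)
  also have "\<dots> = of_real (\<Prod>i<m. (cmod (l i))\<^sup>2) * det (mat m m (\<lambda>(i, j). G i j))"
    unfolding det_scaled_rows_cols of_real_prod complex_norm_square prod.distrib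
    by (simp add: mult.commute)
  finally have "complex_of_real (\<Sum>f\<in>F. (\<Prod>i=0..<m. w (f i)) * h f) =
      of_real (\<Prod>i<m. (cmod (l i))\<^sup>2) * (fact m * det (mat m m (\<lambda>(i, j). G i j)))"
    using det_weighted_gram[where m = m and n = n and w = w and x = x] unfolding F_def h_def by (simp add: mult.left_commute)
  then have "complex_of_real (\<Sum>f\<in>F. (\<Prod>i=0..<m. w (f i)) * h f) =
     of_real ((\<Prod>i<m. (cmod (l i))\<^sup>2) * (\<Sum>f\<in>F. h f))"
    unfolding G1 by simp
  \<comment> \<open>The product of the \<open>(cmod (l i))\<^sup>2\<close> is thus an average of the
    products of the \<open>w (f i)\<close>, with the nonnegative weights \<open>h f\<close>.\<close>
  then have key: "(\<Sum>f\<in>F. (\<Prod>i=0..<m. w (f i)) * h f) = (\<Prod>i<m. (cmod (l i))\<^sup>2) * (\<Sum>f\<in>F. h f)"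
    unfolding of_real_eq_iff .
  have "(\<Sum>f\<in>F. h f) \<noteq> 0"
    using det G1 fact_nonzero[of m, where 'a = complex] by (metis mult_eq_0_iff of_real_0)
  moreover have "0 \<le> (\<Sum>f\<in>F. h f)" by (intro sum_nonneg) (simp add: h_def)
  ultimately have pos: "0 < (\<Sum>f\<in>F. h f)" by simp
  \<comment> \<open>A map that is not injective makes two rows equal.\<close>
  have h0: "h f = 0" if not_inj: "\<not> inj_on f {0..<m}" for f
  proof -
    obtain i j where "i < m" "j < m" "i \<noteq> j" "f i = f j"
      using not_inj unfolding inj_on_def by (metis atLeastLessThan_iff)
    then have "det (mat m m (\<lambda>(i, j). x j (f i))) = 0"
      by (intro det_identical_rows[of _ m i j]) auto
    then show ?thesis by (simp add: h_def)
  qed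
  \<comment> \<open>An injective \<open>f\<close> picks \<open>m\<close> distinct indices below
    \<open>n\<close>; for \<open>m = n\<close> it picks all of them, whence equality.\<close>
  have le: "(\<Prod>i=0..<m. w (f i)) \<le> (\<Prod>i<m. w i)" and
    equal: "m = n \<Longrightarrow> (\<Prod>i=0..<m. w (f i)) = (\<Prod>i<m. w i)"
    if f: "f \<in> F" "inj_on f {0..<m}" for f
  proof -
    have im: "f ` {0..<m} \<subseteq> {..<n}" using f by (auto simp: F_def)
    have c: "card (f ` {0..<m}) = m" using f card_image by fastforce
    have r: "(\<Prod>i=0..<m. w (f i)) = prod w (f ` {0..<m})"
      using prod.reindex[OF f(2), of w] by (simp add: o_def)
    show "(\<Prod>i=0..<m. w (f i)) \<le> (\<Prod>i<m. w i)"
      using prod_antimono_le_initial[OF anti nonneg im] c r by simp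
    show "(\<Prod>i=0..<m. w (f i)) = (\<Prod>i<m. w i)" if "m = n"
      using card_subset_eq[OF _ im] c r that by simp
  qed
  have "(\<Prod>i<m. (cmod (l i))\<^sup>2) * (\<Sum>f\<in>F. h f) \<le> (\<Sum>f\<in>F. (\<Prod>i<m. w i) * h f)"
    unfolding key[symmetric]
  proof (rule sum_mono)
    fix f assume "f \<in> F"
    then show "(\<Prod>i=0..<m. w (f i)) * h f \<le> (\<Prod>i<m. w i) * h f"
      using le[of f] h0[of f] by (cases "inj_on f {0..<m}") (auto simp: h_def intro: mult_right_mono)
  qed
  then show "(\<Prod>i<m. (cmod (l i))\<^sup>2) \<le> (\<Prod>i<m. w i)"
    using pos by (simp flip: sum_distrib_left)
  assume "m = n"
  have "(\<Prod>i<m. (cmod (l i))\<^sup>2) * (\<Sum>f\<in>F. h f) = (\<Sum>f\<in>F. (\<Prod>i<m. w i) * h f)"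
    unfolding key[symmetric]
  proof (rule sum.cong[OF refl])
    fix f assume "f \<in> F"
    then show "(\<Prod>i=0..<m. w (f i)) * h f = (\<Prod>i<m. w i) * h f"
      using equal[of f] h0[of f] \<open>m = n\<close> by (cases "inj_on f {0..<m}") auto
  qed
  then show "(\<Prod>i<m. (cmod (l i))\<^sup>2) = (\<Prod>i<m. w i)"
    using pos by (simp flip: sum_distrib_left)
qed

section \<open>From inequalities between products to inequalities between sums\<close>

text \<open>Summation by parts as an induction: the weighted partial sum dominates its last weight
  times the plain partial sum. Passing to the next, smaller weight preserves this because the plain
  partial sums are nonnegative.\<close>

lemma sum_antimono_mult_nonneg:
  fixes x d :: "nat \<Rightarrow> real"
  assumes "\<And>i j. i \<le> j \<Longrightarrow> j < n \<Longrightarrow> x j \<le> x i" "\<And>i. i < n \<Longrightarrow> 0 \<le> x i"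
    and "\<And>m. m \<le> n \<Longrightarrow> 0 \<le> (\<Sum>i<m. d i)"
  shows "0 \<le> (\<Sum>i<n. x i * d i)"
proof (cases n)
  case (Suc k)
  have "x m * (\<Sum>i<Suc m. d i) \<le> (\<Sum>i<Suc m. x i * d i)" if "m < n" for m
    using that
  proof (induction m)
    case (Suc m)
    have "x (Suc m) * (\<Sum>i<Suc m. d i) \<le> x m * (\<Sum>i<Suc m. d i)"
      using Suc.prems assms(1)[of m "Suc m"] assms(3)[of "Suc m"] by (intro mult_right_mono) auto
    with Suc show ?case by (simp add: distrib_left)
  qed simp
  from this[of k] have "x k * (\<Sum>i<n. d i) \<le> (\<Sum>i<n. x i * d i)"
    using Suc by simp
  moreover have "0 \<le> x k * (\<Sum>i<n. d i)"
    using Suc assms(2)[of k] assms(3)[of n] by (intro mult_nonneg_nonneg) simp_all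
  ultimately show ?thesis by (rule order_trans[rotated])
qed simp

text \<open>With \<open>d\<^sub>i = ln (y\<^sub>i / x\<^sub>i)\<close>, summation by parts gives \<open>0 \<le> \<Sum> x\<^sub>i d\<^sub>i\<close>, and \<open>x\<^sub>i d\<^sub>i \<le> y\<^sub>i - x\<^sub>i\<close>.\<close>

lemma sum_le_of_prod_le:
  fixes x y :: "nat \<Rightarrow> real"
  assumes anti: "\<And>i j. i \<le> j \<Longrightarrow> j < n \<Longrightarrow> x j \<le> x i"
    and pos: "\<And>i. i < n \<Longrightarrow> 0 < x i" "\<And>i. i < n \<Longrightarrow> 0 < y i"
    and prod: "\<And>m. m \<le> n \<Longrightarrow> (\<Prod>i<m. x i) \<le> (\<Prod>i<m. y i)"
  shows "(\<Sum>i<n. x i) \<le> (\<Sum>i<n. y i)"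
proof -
  have "0 \<le> (\<Sum>i<m. ln (y i / x i))" if "m \<le> n" for m
  proof -
    have posm: "0 < x i" "0 < y i" if "i < m" for i
      using pos[of i] that \<open>m \<le> n\<close> by auto
    have "(\<Sum>i<m. ln (y i / x i)) = ln (\<Prod>i<m. y i / x i)"
      using posm by (intro ln_prod[symmetric]) (auto simp: less_imp_neq[symmetric])
    moreover have "1 \<le> (\<Prod>i<m. y i / x i)"
      using prod[OF that] prod_pos[of "{..<m}" x] posm by (simp add: prod_dividef)
    ultimately show ?thesis by simp
  qed
  then have "0 \<le> (\<Sum>i<n. x i * ln (y i / x i))"
    using anti pos(1) by (intro sum_antimono_mult_nonneg) (auto intro: less_imp_le)
  also have "\<dots> \<le> (\<Sum>i<n. y i - x i)"
  proof (rule sum_mono)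
    fix i assume "i \<in> {..<n}"
    then have "0 < x i" "0 < y i" using pos by auto
    then show "x i * ln (y i / x i) \<le> y i - x i"
      using mult_left_mono[OF ln_le_minus_one[of "y i / x i"], of "x i"]
      by (simp add: right_diff_distrib)
  qed
  finally show ?thesis by (simp add: sum_subtractf)
qed

section \<open>The inner product of the Hardy space\<close>

lemma sum_fun_apply: "(sum f S :: 'a \<Rightarrow> 'b::comm_monoid_add) x = (\<Sum>i\<in>S. f i x)"
  by (induction S rule: infinite_finite_induct) simp_all

lemma taylor_coeff_add:
  assumes "f \<in> hardy_space" "g \<in> hardy_space"
  shows "taylor_coeff (f + g) n = taylor_coeff f n + taylor_coeff g n"
  using assms higher_deriv_add[of f "ball 0 1" g 0 n]
  by (simp add: hardy_space_def taylor_coeff_def plus_fun_def add_divide_distrib)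

lemma taylor_coeff_scale:
  assumes "f \<in> hardy_space"
  shows "taylor_coeff (\<lambda>z. c * f z) n = c * taylor_coeff f n"
  using assms higher_deriv_cmult[of f "ball 0 1" 0 n c]
  by (simp add: hardy_space_def taylor_coeff_def)

lemma hardy_inner_summable:
  assumes "f \<in> hardy_space" "g \<in> hardy_space"
  shows "summable (\<lambda>n. taylor_coeff f n * cnj (taylor_coeff g n))"
proof (rule summable_comparison_test')
  show "summable (\<lambda>n. (cmod (taylor_coeff f n))\<^sup>2 + (cmod (taylor_coeff g n))\<^sup>2)"
    using assms by (intro summable_add) (auto simp: hardy_space_def)
  show "norm (taylor_coeff f n * cnj (taylor_coeff g n))
      \<le> (cmod (taylor_coeff f n))\<^sup>2 + (cmod (taylor_coeff g n))\<^sup>2" for n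
    using sum_squares_bound[of "cmod (taylor_coeff f n)" "cmod (taylor_coeff g n)"]
      mult_nonneg_nonneg[OF norm_ge_zero[of "taylor_coeff f n"] norm_ge_zero[of "taylor_coeff g n"]]
    unfolding norm_mult complex_mod_cnj by linarith
qed

lemma hardy_inner_add_left:
  assumes "f \<in> hardy_space" "g \<in> hardy_space" "h \<in> hardy_space"
  shows "hardy_inner (f + g) h = hardy_inner f h + hardy_inner g h"
  using suminf_add[OF hardy_inner_summable[OF assms(1,3)] hardy_inner_summable[OF assms(2,3)]]
  by (simp add: hardy_inner_def taylor_coeff_add assms distrib_right)

lemma hardy_inner_scale_left:
  assumes "f \<in> hardy_space" "h \<in> hardy_space"
  shows "hardy_inner (\<lambda>z. c * f z) h = c * hardy_inner f h"
  using suminf_mult[OF hardy_inner_summable[OF assms], of c]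
  by (simp add: hardy_inner_def taylor_coeff_scale assms mult.assoc)

lemma hardy_inner_commute:
  assumes "f \<in> hardy_space" "g \<in> hardy_space"
  shows "hardy_inner g f = cnj (hardy_inner f g)"
proof -
  have "(\<lambda>n. cnj (taylor_coeff f n * cnj (taylor_coeff g n))) sums cnj (hardy_inner f g)"
    unfolding sums_cnj hardy_inner_def by (rule summable_sums[OF hardy_inner_summable[OF assms]])
  then show ?thesis by (simp add: hardy_inner_def sums_iff mult.commute)
qed

lemma hardy_inner_self:
  assumes "f \<in> hardy_space"
  shows "hardy_inner f f = of_real (\<Sum>n. (cmod (taylor_coeff f n))\<^sup>2)"
  using assms suminf_of_real[of "\<lambda>n. (cmod (taylor_coeff f n))\<^sup>2", where 'a = complex]
  by (simp add: hardy_inner_def hardy_space_def complex_norm_square del: of_real_power)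

text \<open>A vanishing norm kills all Taylor coefficients, hence the function on the disk; outside
  the disk it is \<open>0\<close> by convention.\<close>

lemma hardy_inner_eq_0:
  assumes "f \<in> hardy_space" "hardy_inner f f = 0"
  shows "f = 0"
proof
  fix z
  have "(\<Sum>n. (cmod (taylor_coeff f n))\<^sup>2) = 0"
    using assms(2) unfolding hardy_inner_self[OF assms(1)] by simp
  then have "taylor_coeff f n = 0" for n
    using assms(1) suminf_eq_zero_iff[of "\<lambda>n. (cmod (taylor_coeff f n))\<^sup>2"]
    by (simp add: hardy_space_def)
  moreover have "(\<lambda>n. taylor_coeff f n * z ^ n) sums f z" if "z \<in> ball 0 1"
    using holomorphic_power_series[of f 0 1 z] assms(1) that
    by (simp add: hardy_space_def taylor_coeff_def)
  ultimately show "f z = 0 z"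
    using assms(1) sums_unique2[OF _ sums_zero] by (cases "z \<in> ball 0 1") (auto simp: hardy_space_def)
qed

lemma hardy_inner_self_nonneg:
  assumes "f \<in> hardy_space"
  shows "hardy_inner f f = of_real (Re (hardy_inner f f))" "0 \<le> Re (hardy_inner f f)"
  using assms by (auto simp: hardy_inner_self hardy_space_def intro: suminf_nonneg)

lemma hardy_inner_add_right:
  assumes "f \<in> hardy_space" "g \<in> hardy_space" "h \<in> hardy_space"
  shows "hardy_inner h (f + g) = hardy_inner h f + hardy_inner h g"
  using assms hardy_inner_add_left[of f g h] hardy_space_subspace
  by (simp add: hardy_inner_commute[of _ h] cfun.subspace_add)

lemma hardy_inner_scale_right:
  assumes "f \<in> hardy_space" "h \<in> hardy_space"
  shows "hardy_inner h (\<lambda>z. c * f z) = cnj c * hardy_inner h f"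
  using assms hardy_inner_scale_left[of f h] hardy_space_subspace
  by (simp add: hardy_inner_commute[of _ h] cfun.subspace_scale)

lemma hardy_inner_diff_left:
  assumes "f \<in> hardy_space" "g \<in> hardy_space" "h \<in> hardy_space"
  shows "hardy_inner (f - g) h = hardy_inner f h - hardy_inner g h"
  using hardy_inner_add_left[of "f - g" g h] assms hardy_space_subspace
  by (simp add: cfun.subspace_diff)

lemma hardy_inner_diff_right:
  assumes "f \<in> hardy_space" "g \<in> hardy_space" "h \<in> hardy_space"
  shows "hardy_inner h (f - g) = hardy_inner h f - hardy_inner h g"
  using hardy_inner_add_right[of "f - g" g h] assms hardy_space_subspace
  by (simp add: cfun.subspace_diff)

lemma hardy_inner_zero_left: "hardy_inner 0 h = 0"
  and hardy_inner_zero_right: "hardy_inner h 0 = 0"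
  by (simp_all add: hardy_inner_def taylor_coeff_def zero_fun_def)

lemma hardy_inner_sum_left:
  assumes "\<And>i. i \<in> S \<Longrightarrow> f i \<in> hardy_space" "h \<in> hardy_space"
  shows "hardy_inner (\<Sum>i\<in>S. (\<lambda>z. c i * f i z)) h = (\<Sum>i\<in>S. c i * hardy_inner (f i) h)"
  using assms(1)
proof (induction S rule: infinite_finite_induct)
  case (insert i S)
  have "(\<Sum>i\<in>S. (\<lambda>z. c i * f i z)) \<in> hardy_space"
    using insert.prems by (intro cfun.subspace_sum cfun.subspace_scale hardy_space_subspace) auto
  then have "hardy_inner ((\<lambda>z. c i * f i z) + (\<Sum>i\<in>S. (\<lambda>z. c i * f i z))) h =
      c i * hardy_inner (f i) h + hardy_inner (\<Sum>i\<in>S. (\<lambda>z. c i * f i z)) h"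
    using insert.prems assms(2) hardy_space_subspace
    by (subst hardy_inner_add_left) (auto simp: hardy_inner_scale_left cfun.subspace_scale)
  then show ?case
    using insert by (simp only: sum.insert[OF insert(1,2)]) simp
qed (simp_all add: hardy_inner_zero_left)

definition orthonormal :: "nat \<Rightarrow> (nat \<Rightarrow> complex \<Rightarrow> complex) \<Rightarrow> bool" where
  "orthonormal n e \<longleftrightarrow> (\<forall>i<n. e i \<in> hardy_space) \<and>
     (\<forall>i<n. \<forall>j<n. hardy_inner (e i) (e j) = (if i = j then 1 else 0))"

lemma hardy_orthogonal_complement_span:
  assumes "S \<subseteq> hardy_space" "f \<in> hardy_space" "\<And>g. g \<in> S \<Longrightarrow> hardy_inner f g = 0"
    and "h \<in> cfun.span S"
  shows "hardy_inner f h = 0"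
proof -
  have "cfun.subspace {g \<in> hardy_space. hardy_inner f g = 0}"
    using hardy_space_subspace assms(2)
    by (intro cfun.subspaceI)
       (auto simp: hardy_inner_zero_right hardy_inner_add_right hardy_inner_scale_right
          cfun.subspace_add cfun.subspace_scale cfun.subspace_0)
  then have "cfun.span S \<subseteq> {g \<in> hardy_space. hardy_inner f g = 0}"
    using assms by (intro cfun.span_minimal) auto
  then show ?thesis using assms(4) by auto
qed

section \<open>Self-adjoint operators on finite-dimensional subspaces\<close>

text \<open>Meant for the iterates of an operator at a vector. It speaks of a sequence instead of a
  set, since a repeated member is already a dependence.\<close>

lemma family_dependent:
  assumes "finite F" "\<And>i. u i \<in> cfun.span F"
  obtains c :: "nat \<Rightarrow> complex" and N i where "i \<le> N" "c i \<noteq> 0" "(\<Sum>i\<le>N. (\<lambda>z. c i * u i z)) = 0"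
proof (cases "inj_on u {..card F}")
  case False
  then obtain i j where ij: "i < j" "u i = u j"
    unfolding inj_on_def by (metis linorder_neqE_nat)
  define c where "c k = (if k = j then 1 else if k = i then - 1 else 0 :: complex)" for k
  have "(\<Sum>k\<le>j. (\<lambda>z. c k * u k z)) = (\<Sum>k\<in>{i, j}. (\<lambda>z. c k * u k z))"
    using ij by (intro sum.mono_neutral_right) (auto simp: c_def fun_eq_iff)
  also have "\<dots> = 0" using ij by (simp add: c_def fun_eq_iff)
  finally show thesis using ij by (intro that[of j j c]) (auto simp: c_def)
next
  case True
  have "\<not> cfun.independent (u ` {..card F})"
    using cfun.independent_span_bound[OF assms(1), of "u ` {..card F}"] assms(2) card_image[OF True]
    by auto
  then obtain d v where d: "v \<in> u ` {..card F}" "d v \<noteq> 0"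
    "(\<Sum>v\<in>u ` {..card F}. (\<lambda>z. d v * v z)) = 0"
    using cfun.dependent_finite[of "u ` {..card F}"] by auto
  from d(1) obtain i where "i \<le> card F" "v = u i" by auto
  with d show thesis
    by (intro that[of i "card F" "\<lambda>i. d (u i)"]) (simp_all add: sum.reindex[OF True] o_def)
qed

text \<open>Linearity is asked for on \<open>V\<close> only: the operators in question are built
  from projections defined by \<open>THE\<close>, which are controlled only on spans of
  kernels.\<close>

locale cfun_endomorphism =
  fixes V :: "('a \<Rightarrow> complex) set" and L :: "('a \<Rightarrow> complex) \<Rightarrow> 'a \<Rightarrow> complex"
  assumes subspace: "cfun.subspace V"
    and into: "f \<in> V \<Longrightarrow> L f \<in> V"
    and add: "f \<in> V \<Longrightarrow> g \<in> V \<Longrightarrow> L (f + g) = L f + L g"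
    and scale: "f \<in> V \<Longrightarrow> L (\<lambda>z. c * f z) = (\<lambda>z. c * L f z)"
begin

lemma zero: "L 0 = 0"
  using scale[of 0 0] cfun.subspace_0[OF subspace] by (simp add: zero_fun_def)

lemma sum: "(\<And>i. i \<in> S \<Longrightarrow> f i \<in> V) \<Longrightarrow>
    L (\<Sum>i\<in>S. (\<lambda>z. c i * f i z)) = (\<Sum>i\<in>S. (\<lambda>z. c i * L (f i) z))"
proof (induction S rule: infinite_finite_induct)
  case (insert i S)
  have "(\<Sum>i\<in>S. (\<lambda>z. c i * f i z)) \<in> V"
    using insert.prems by (intro cfun.subspace_sum cfun.subspace_scale subspace) auto
  then have "L ((\<lambda>z. c i * f i z) + (\<Sum>i\<in>S. (\<lambda>z. c i * f i z))) =
      (\<lambda>z. c i * L (f i) z) + L (\<Sum>i\<in>S. (\<lambda>z. c i * f i z))"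
    using insert.prems cfun.subspace_scale[OF subspace] by (subst add) (auto simp: scale)
  then show ?case
    using insert by (simp only: sum.insert[OF insert(1,2)]) simp
qed (simp_all add: zero)

text \<open>Induction on the degree: a root \<open>c\<close> splits off a factor,
  \<open>p = (X - c) q\<close>. Then \<open>q(L) v\<close> is an eigenvector for \<open>c\<close>,
  or it is zero and \<open>q\<close> is an annihilator of smaller degree.\<close>

lemma eigenvector_of_annihilator:
  fixes p :: "complex poly"
  assumes "v \<in> V" "v \<noteq> 0" "p \<noteq> 0" "(\<Sum>i\<le>degree p. (\<lambda>z. coeff p i * (L ^^ i) v z)) = 0"
  shows "\<exists>c. \<exists>f\<in>V. f \<noteq> 0 \<and> L f = (\<lambda>z. c * f z)"
  using assms(3,4)
proof (induction "degree p" arbitrary: p)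
  case 0
  then obtain a where "p = [:a:]" "a \<noteq> 0" by (metis degree_eq_zeroE pCons_eq_0_iff)
  then have "v z = 0" for z using fun_cong[OF 0(3), of z] by simp
  then show ?case using assms(2) by (auto simp: fun_eq_iff)
next
  case (Suc k)
  then obtain c where "poly p c = 0" using alg_closed_imp_poly_has_root[of p] by auto
  then obtain q where q: "p = [:- c, 1:] * q" by (auto simp: poly_eq_0_iff_dvd)
  then have q0: "q \<noteq> 0" using Suc.prems by auto
  have dq: "degree p = Suc (degree q)" unfolding q by (subst degree_mult_eq) (use q0 in auto)
  have Li: "(L ^^ i) v \<in> V" for i using assms(1) into by (induction i) auto
  define w where "w = (\<Sum>i\<le>degree q. (\<lambda>z. coeff q i * (L ^^ i) v z))"
  have wV: "w \<in> V" unfolding w_def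
    using Li by (intro cfun.subspace_sum cfun.subspace_scale subspace) auto
  have "L w = (\<lambda>z. c * w z)"
  proof
    fix z
    have Lw: "L w z = (\<Sum>i\<le>degree q. coeff q i * (L ^^ Suc i) v z)"
      unfolding w_def by (subst sum) (auto simp: Li sum_fun_apply)
    have cw: "c * w z = (\<Sum>i\<le>Suc (degree q). c * coeff q i * (L ^^ i) v z)"
      by (simp add: w_def sum_fun_apply sum_distrib_left mult.assoc coeff_eq_0)
    have "0 = (\<Sum>i\<le>Suc (degree q). coeff p i * (L ^^ i) v z)"
      using fun_cong[OF Suc.prems(2), of z] by (simp add: sum_fun_apply dq)
    \<comment> \<open>Multiplying \<open>q\<close> by \<open>X\<close> shifts its coefficients and
      corresponds to applying \<open>L\<close> to \<open>w\<close>.\<close>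
    also have "\<dots> = (\<Sum>i\<le>Suc (degree q). coeff (pCons 0 q) i * (L ^^ i) v z) - c * w z"
      unfolding cw sum_subtractf[symmetric] q by (intro sum.cong) (auto simp: algebra_simps)
    also have "(\<Sum>i\<le>Suc (degree q). coeff (pCons 0 q) i * (L ^^ i) v z) = L w z"
      unfolding Lw by (subst sum.atMost_Suc_shift) simp
    finally show "L w z = c * w z" by simp
  qed
  moreover have ?case if "w = 0"
    using Suc.hyps(1)[of q] Suc.hyps(2) q0 that dq by (simp add: w_def)
  ultimately show ?case using wV by blast
qed

text \<open>In finite dimension the iterates of \<open>L\<close> at \<open>v\<close> are dependent,
  and the coefficients of a dependence form a nonzero annihilating polynomial.\<close>

lemma eigenvector_exists:
  assumes "finite F" "V \<subseteq> cfun.span F" "v \<in> V" "v \<noteq> 0"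
  shows "\<exists>c. \<exists>f\<in>V. f \<noteq> 0 \<and> L f = (\<lambda>z. c * f z)"
proof -
  have Li: "(L ^^ i) v \<in> V" for i using assms(3) into by (induction i) auto
  obtain c N j where c: "j \<le> N" "c j \<noteq> 0" "(\<Sum>i\<le>N. (\<lambda>z. c i * (L ^^ i) v z)) = 0"
    by (rule family_dependent[OF assms(1), of "\<lambda>i. (L ^^ i) v"]) (use Li assms(2) in auto)
  define p where "p = (\<Sum>i\<le>N. monom (c i) i)"
  have p: "coeff p i = (if i \<le> N then c i else 0)" for i
    by (simp add: p_def coeff_sum)
  have "p \<noteq> 0" using c p[of j] by auto
  \<comment> \<open>The last coefficients of the dependence may vanish, so the sum has to be cut off
    at \<open>degree p\<close>.\<close>
  moreover have "degree p \<le> N" by (rule degree_le) (simp add: p)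
  then have "(\<Sum>i\<le>degree p. (\<lambda>z. coeff p i * (L ^^ i) v z)) =
      (\<Sum>i\<le>N. (\<lambda>z. coeff p i * (L ^^ i) v z))"
    by (intro sum.mono_neutral_left) (auto simp: fun_eq_iff coeff_eq_0)
  then have "(\<Sum>i\<le>degree p. (\<lambda>z. coeff p i * (L ^^ i) v z)) = 0"
    using c(3) p by simp
  ultimately show ?thesis using c assms by (intro eigenvector_of_annihilator[of v p]) auto
qed

end

section \<open>Finite orthonormal families and their spans\<close>

lemma hardy_orthogonal_independent:
  assumes "finite S" "S \<subseteq> hardy_space" "0 \<notin> S"
    and "\<And>f g. f \<in> S \<Longrightarrow> g \<in> S \<Longrightarrow> f \<noteq> g \<Longrightarrow> hardy_inner f g = 0"
  shows "cfun.independent S"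
  using assms
proof (induction S rule: finite_induct)
  case (insert f S)
  have "f \<notin> cfun.span S"
  proof
    assume "f \<in> cfun.span S"
    then have "hardy_inner f f = 0"
      by (rule hardy_orthogonal_complement_span[rotated 3]) (use insert in auto)
    then show False using insert.prems hardy_inner_eq_0[of f] by auto
  qed
  with insert show ?case by (intro cfun.independent_insertI) auto
qed (simp add: cfun.independent_empty)

lemma orthonormal_independent:
  assumes "orthonormal n e" "I \<subseteq> {..<n}"
  shows "cfun.independent (e ` I)" "inj_on e I"
proof -
  show inj: "inj_on e I"
    using assms unfolding orthonormal_def inj_on_def by (metis lessThan_iff subsetD zero_neq_one)
  show "cfun.independent (e ` I)"
  proof (rule hardy_orthogonal_independent)
    show "finite (e ` I)" using assms(2) finite_subset by blast
    show "0 \<notin> e ` I"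
      using assms unfolding orthonormal_def
      by (metis hardy_inner_zero_left imageE lessThan_iff subsetD zero_neq_one)
    show "hardy_inner f g = 0" if "f \<in> e ` I" "g \<in> e ` I" "f \<noteq> g" for f g
    proof -
      from that obtain i j where "f = e i" "g = e j" "i \<in> I" "j \<in> I" "i \<noteq> j" by blast
      moreover have "i < n" "j < n" using assms(2) \<open>i \<in> I\<close> \<open>j \<in> I\<close> by auto
      ultimately show ?thesis using assms(1) by (simp add: orthonormal_def)
    qed
    show "e ` I \<subseteq> hardy_space"
      using assms unfolding orthonormal_def by blast
  qed
qed

lemma orthonormal_residual:
  assumes e: "orthonormal n e" and f: "f \<in> hardy_space"
  defines "g \<equiv> (\<Sum>k<n. (\<lambda>z. hardy_inner f (e k) * e k z))"
  shows "g \<in> cfun.span (e ` {..<n})" "g \<in> hardy_space" "i < n \<Longrightarrow> hardy_inner (f - g) (e i) = 0"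
proof -
  show "g \<in> cfun.span (e ` {..<n})"
    unfolding g_def by (intro cfun.span_sum cfun.span_scale cfun.span_base) auto
  show g: "g \<in> hardy_space"
    unfolding g_def using e
    by (intro cfun.subspace_sum cfun.subspace_scale hardy_space_subspace) (auto simp: orthonormal_def)
  assume i: "i < n"
  have "hardy_inner g (e i) = (\<Sum>k<n. hardy_inner f (e k) * hardy_inner (e k) (e i))"
    unfolding g_def using e i by (intro hardy_inner_sum_left) (auto simp: orthonormal_def)
  also have "\<dots> = (\<Sum>k<n. if k = i then hardy_inner f (e k) else 0)"
    using e i by (intro sum.cong) (auto simp: orthonormal_def)
  also have "\<dots> = hardy_inner f (e i)" using i by simp
  finally show "hardy_inner (f - g) (e i) = 0"
    using e i f g by (simp add: hardy_inner_diff_left orthonormal_def)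
qed

text \<open>The difference of \<open>f\<close> and its Fourier sum lies in the span and is
  orthogonal to it, hence to itself.\<close>

lemma orthonormal_expansion:
  assumes e: "orthonormal n e" and f: "f \<in> cfun.span (e ` {..<n})"
  shows "f = (\<Sum>k<n. (\<lambda>z. hardy_inner f (e k) * e k z))"
proof -
  have sub: "e ` {..<n} \<subseteq> hardy_space" using e by (auto simp: orthonormal_def)
  have fH: "f \<in> hardy_space" using f cfun.span_minimal[OF sub hardy_space_subspace] by auto
  define g where "g = (\<Sum>k<n. (\<lambda>z. hardy_inner f (e k) * e k z))"
  note g = orthonormal_residual[OF e fH, folded g_def]
  have "f - g \<in> cfun.span (e ` {..<n})" using f g(1) by (rule cfun.span_diff)
  moreover have fg: "f - g \<in> hardy_space"
    by (rule cfun.subspace_diff[OF hardy_space_subspace fH g(2)])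
  moreover have "hardy_inner (f - g) h = 0" if "h \<in> e ` {..<n}" for h
    using that g(3) by blast
  ultimately have "hardy_inner (f - g) (f - g) = 0"
    using hardy_orthogonal_complement_span[OF sub fg] by blast
  from hardy_inner_eq_0[OF fg this] show ?thesis unfolding right_minus_eq g_def .
qed

lemma orthonormal_parseval:
  assumes e: "orthonormal n e" and f: "f \<in> cfun.span (e ` {..<n})" and g: "g \<in> hardy_space"
  shows "hardy_inner f g = (\<Sum>k<n. hardy_inner f (e k) * cnj (hardy_inner g (e k)))"
proof -
  have eH: "e k \<in> hardy_space" if "k < n" for k using e that by (simp add: orthonormal_def)
  have "hardy_inner f g = (\<Sum>k<n. hardy_inner f (e k) * hardy_inner (e k) g)"
    by (subst orthonormal_expansion[OF e f], subst hardy_inner_sum_left) (use eH g in auto)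
  then show ?thesis using eH g by (simp add: hardy_inner_commute[of g])
qed

text \<open>Subtracting from \<open>f\<close> its Fourier sum leaves an element of \<open>V\<close>
  orthogonal to the family, to which \<open>max\<close> applies. Both eigenbases below are shown to
  span in this way.\<close>

lemma orthonormal_spanI:
  assumes e: "orthonormal n e" and V: "cfun.subspace V" "V \<subseteq> hardy_space" "e ` {..<n} \<subseteq> V"
    and max: "\<And>f. f \<in> V \<Longrightarrow> (\<And>k. k < n \<Longrightarrow> hardy_inner f (e k) = 0) \<Longrightarrow> f = 0"
  shows "V = cfun.span (e ` {..<n})"
proof
  show "cfun.span (e ` {..<n}) \<subseteq> V" using V by (intro cfun.span_minimal)
  show "V \<subseteq> cfun.span (e ` {..<n})"
  proof
    fix f assume f: "f \<in> V"
    define g where "g = (\<Sum>k<n. (\<lambda>z. hardy_inner f (e k) * e k z))"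
    have g: "g \<in> cfun.span (e ` {..<n})" "\<And>k. k < n \<Longrightarrow> hardy_inner (f - g) (e k) = 0"
      using orthonormal_residual[OF e, of f] V(2) f by (auto simp: g_def)
    then have "g \<in> V" using V cfun.span_minimal[of "e ` {..<n}" V] by auto
    then have "f - g = 0" using f V(1) g(2) by (intro max) (auto intro: cfun.subspace_diff)
    then show "f \<in> cfun.span (e ` {..<n})" using g(1) by simp
  qed
qed

lemma hardy_normalize:
  assumes "f \<in> hardy_space" "f \<noteq> 0"
  obtains c where "hardy_inner (\<lambda>z. c * f z) (\<lambda>z. c * f z) = 1"
proof -
  define r where "r = Re (hardy_inner f f)"
  have r: "hardy_inner f f = of_real r" "r > 0"
    using hardy_inner_self_nonneg[OF assms(1)] hardy_inner_eq_0[OF assms(1)] assms(2)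
    by (auto simp: r_def less_le)
  define c where "c = complex_of_real (1 / sqrt r)"
  have c: "c * (cnj c * of_real r) = 1"
    unfolding c_def complex_cnj_complex_of_real of_real_mult[symmetric]
    using r(2) by (simp add: field_simps flip: of_real_mult)
  have "hardy_inner (\<lambda>z. c * f z) (\<lambda>z. c * f z) = c * (cnj c * of_real r)"
    using assms(1) r(1) cfun.subspace_scale[OF hardy_space_subspace]
    by (simp add: hardy_inner_scale_left hardy_inner_scale_right)
  then show thesis using c that by simp
qed

text \<open>A maximal orthonormal family of eigenvectors spans, because the orthogonal complement of
  its span is again invariant.\<close>

theorem hardy_spectral_theorem:
  assumes "cfun_endomorphism V L" and VH: "V \<subseteq> hardy_space" and F: "finite F" "V \<subseteq> cfun.span F"
    and adj: "\<And>f g. f \<in> V \<Longrightarrow> g \<in> V \<Longrightarrow> hardy_inner (L f) g = hardy_inner f (L g)"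
  obtains n e \<mu> where "orthonormal n e" "V = cfun.span (e ` {..<n})"
    "\<And>i. i < n \<Longrightarrow> L (e i) = (\<lambda>z. complex_of_real (\<mu> i) * e i z)"
proof -
  interpret cfun_endomorphism V L by fact
  define ok where "ok n e \<longleftrightarrow> orthonormal n e \<and>
    (\<forall>i<n. e i \<in> V \<and> (\<exists>c. L (e i) = (\<lambda>z. c * e i z)))" for n e
  have bound: "n \<le> card F" if "ok n e" for n e
  proof -
    have "orthonormal n e" "e ` {..<n} \<subseteq> cfun.span F" using that F by (auto simp: ok_def)
    then show ?thesis
      using orthonormal_independent[of n e "{..<n}"] cfun.independent_span_bound[OF F(1), of "e ` {..<n}"]
      by (simp add: card_image)
  qed
  \<comment> \<open>Independence bounds the length of these families by \<open>card F\<close>, and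
    the empty family is one, so there is a longest.\<close>
  define N where "N = Max {n. \<exists>e. ok n e}"
  have fin: "finite {n. \<exists>e. ok n e}" using bound by (auto intro: finite_subset[of _ "{..card F}"])
  moreover have "ok 0 e" for e by (simp add: ok_def orthonormal_def)
  then have "{n. \<exists>e. ok n e} \<noteq> {}" by blast
  ultimately have "N \<in> {n. \<exists>e. ok n e}" unfolding N_def by (rule Max_in)
  then obtain e where e: "ok N e" by blast
  have Nmax: "\<not> ok (Suc N) e'" for e'
    using Max_ge[OF fin, of "Suc N"] by (auto simp: N_def)
  have on: "orthonormal N e" and eV: "\<And>i. i < N \<Longrightarrow> e i \<in> V" using e by (auto simp: ok_def)
  define W where "W = {f \<in> V. \<forall>k<N. hardy_inner f (e k) = 0}"
  have eH: "\<And>i. i < N \<Longrightarrow> e i \<in> hardy_space" using eV VH by auto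
  have "cfun_endomorphism W L"
  proof
    show "cfun.subspace W"
      using subspace VH eH unfolding W_def
      by (intro cfun.subspaceI)
         (auto simp: cfun.subspace_0 cfun.subspace_add cfun.subspace_scale hardy_inner_zero_left
           hardy_inner_add_left hardy_inner_scale_left subset_iff)
    show "L f \<in> W" if "f \<in> W" for f
    proof -
      have "hardy_inner (L f) (e k) = 0" if k: "k < N" for k
      proof -
        obtain c where "L (e k) = (\<lambda>z. c * e k z)" using e k by (auto simp: ok_def)
        then show ?thesis
          using adj[of f "e k"] \<open>f \<in> W\<close> eV[OF k] eH[OF k] VH k
          by (auto simp: W_def hardy_inner_scale_right subset_iff)
      qed
      then show ?thesis using that into by (auto simp: W_def)
    qed
  qed (auto simp: W_def add scale)
  then interpret W: cfun_endomorphism W L .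
  \<comment> \<open>A nonzero element of \<open>W\<close> yields an eigenvector in \<open>W\<close>,
    which after normalization extends the longest family.\<close>
  have "f = 0" if fW: "f \<in> W" for f
  proof (rule ccontr)
    assume "f \<noteq> 0"
    then obtain c g where g: "g \<in> W" "g \<noteq> 0" "L g = (\<lambda>z. c * g z)"
      using W.eigenvector_exists[OF F(1) _ fW] F(2) by (auto simp: W_def)
    have "g \<in> hardy_space" using g VH by (auto simp: W_def)
    then obtain d where d: "hardy_inner (\<lambda>z. d * g z) (\<lambda>z. d * g z) = 1"
      using hardy_normalize g(2) by blast
    define h where "h = (\<lambda>z. d * g z)"
    have hW: "h \<in> W" using cfun.subspace_scale[OF W.subspace g(1), of d] by (simp add: h_def)
    have Lh: "L h = (\<lambda>z. c * h z)"
      unfolding h_def W.scale[OF g(1)] g(3) by (simp add: mult.left_commute)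
    have hH: "h \<in> hardy_space" using hW VH by (auto simp: W_def)
    have h0: "hardy_inner h (e k) = 0" "hardy_inner (e k) h = 0" if "k < N" for k
      using hW that hardy_inner_commute[OF hH eH[OF that]] by (auto simp: W_def)
    have "ok (Suc N) (e(N := h))"
      unfolding ok_def orthonormal_def
      using e hH hW h0 d Lh by (auto simp: ok_def orthonormal_def less_Suc_eq W_def h_def[symmetric])
    then show False using Nmax by blast
  qed
  then have V: "V = cfun.span (e ` {..<N})"
    using on subspace VH eV by (intro orthonormal_spanI) (auto simp: W_def)
  define \<mu> where "\<mu> i = Re (hardy_inner (L (e i)) (e i))" for i
  show thesis
  proof (rule that[OF on V])
    fix i assume i: "i < N"
    then obtain c where c: "L (e i) = (\<lambda>z. c * e i z)" using e by (auto simp: ok_def)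
    have one: "hardy_inner (e i) (e i) = 1" using on i by (simp add: orthonormal_def)
    \<comment> \<open>Self-adjointness identifies \<open>c\<close> with its conjugate, so the
      eigenvalue is real.\<close>
    have "hardy_inner (L (e i)) (e i) = c" "hardy_inner (e i) (L (e i)) = cnj c"
      using eH[OF i] one by (simp_all add: c hardy_inner_scale_left hardy_inner_scale_right)
    then have "c = of_real (\<mu> i)"
      using adj[OF eV eV, OF i i] by (auto simp: \<mu>_def complex_eq_iff)
    then show "L (e i) = (\<lambda>z. complex_of_real (\<mu> i) * e i z)" using c by simp
  qed
qed

section \<open>Singular values from an eigenbasis\<close>

text \<open>Grouping equal values brings the multiset to the shape in which
  \<open>singular_values\<close> is defined.\<close>

lemma image_mset_mset_set_conv_sum:
  assumes "finite F"
  shows "image_mset g (mset_set F) = (\<Sum>s\<in>g ` F. replicate_mset (card {k \<in> F. g k = s}) s)"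
proof (rule multiset_eqI)
  fix s
  have "count (image_mset g (mset_set F)) s = card {k \<in> F. g k = s}"
  proof -
    have "count (image_mset g (mset_set F)) s = (\<Sum>y\<in>g -` {s} \<inter> F. 1)"
      unfolding count_image_mset using assms by (intro sum.cong) auto
    also have "g -` {s} \<inter> F = {k \<in> F. g k = s}" by auto
    finally show ?thesis by simp
  qed
  moreover have "count (\<Sum>t\<in>g ` F. replicate_mset (card {k \<in> F. g k = t}) t) s =
      (if s \<in> g ` F then card {k \<in> F. g k = s} else 0)"
    using assms by (simp add: count_sum)
  moreover have "card {k \<in> F. g k = s} = 0" if "s \<notin> g ` F"
    using that by (auto simp: card_eq_0_iff)
  ultimately show "count (image_mset g (mset_set F)) s =
      count (\<Sum>t\<in>g ` F. replicate_mset (card {k \<in> F. g k = t}) t) s"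
    by auto
qed

lemma orthonormal_eqI:
  assumes e: "orthonormal n e" and "f \<in> cfun.span (e ` {..<n})" "g \<in> cfun.span (e ` {..<n})"
    and "\<And>k. k < n \<Longrightarrow> hardy_inner f (e k) = hardy_inner g (e k)"
  shows "f = g"
proof -
  have "f = (\<Sum>k<n. (\<lambda>z. hardy_inner f (e k) * e k z))" by (rule orthonormal_expansion[OF e assms(2)])
  also have "\<dots> = (\<Sum>k<n. (\<lambda>z. hardy_inner g (e k) * e k z))"
    by (intro sum.cong refl) (simp add: assms(4))
  also have "\<dots> = g" by (rule orthonormal_expansion[OF e assms(3), symmetric])
  finally show ?thesis .
qed

text \<open>The adjoint of \<open>T\<close> composed with \<open>T\<close> is diagonal in the basis
  \<open>e\<close>. This is put in terms of coefficients because moving projections across the inner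
  product delivers it in that form.\<close>

context
  fixes n :: nat and e :: "nat \<Rightarrow> complex \<Rightarrow> complex" and \<mu> :: "nat \<Rightarrow> real" and V T
  assumes e: "orthonormal n e" and V: "V = cfun.span (e ` {..<n})"
    and into: "\<And>g. g \<in> V \<Longrightarrow> hardy_adjoint V T (T g) \<in> V"
    and inner: "\<And>g k. g \<in> V \<Longrightarrow> k < n \<Longrightarrow>
        hardy_inner (hardy_adjoint V T (T g)) (e k) = complex_of_real (\<mu> k) * hardy_inner g (e k)"
    and nonneg: "\<And>k. k < n \<Longrightarrow> 0 \<le> \<mu> k"
begin

text \<open>Compare coefficients: at an index where \<open>\<mu> k\<close> differs from
  \<open>s\<^sup>2\<close>, the coefficient of \<open>g\<close> has to vanish.\<close>

lemma singular_space_eigenbasis: "singular_space V T s = cfun.span (e ` {k. k < n \<and> \<mu> k = s\<^sup>2})"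
  (is "_ = cfun.span (e ` ?I)")
proof
  have eH: "e k \<in> hardy_space" if "k < n" for k using e that by (simp add: orthonormal_def)
  have VH: "V \<subseteq> hardy_space"
    unfolding V using eH by (intro cfun.span_minimal hardy_space_subspace) auto
  show "singular_space V T s \<subseteq> cfun.span (e ` ?I)"
  proof
    fix g assume "g \<in> singular_space V T s"
    then have g: "g \<in> V" "hardy_adjoint V T (T g) = (\<lambda>z. complex_of_real (s\<^sup>2) * g z)"
      by (simp_all add: singular_space_def)
    have "(\<lambda>z. hardy_inner g (e k) * e k z) \<in> cfun.span (e ` ?I)" if k: "k < n" for k
    proof (cases "\<mu> k = s\<^sup>2")
      case True
      with k show ?thesis by (intro cfun.span_scale cfun.span_base) auto
    next
      case False
      have "complex_of_real (s\<^sup>2) * hardy_inner g (e k) = complex_of_real (\<mu> k) * hardy_inner g (e k)"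
        using inner[OF g(1) k] hardy_inner_scale_left[of g "e k" "complex_of_real (s\<^sup>2)"] g VH eH[OF k]
        by auto
      then have "hardy_inner g (e k) = 0" using False by (metis mult_cancel_right of_real_eq_iff)
      then have zero: "(\<lambda>z. hardy_inner g (e k) * e k z) = 0" by (simp add: fun_eq_iff)
      show ?thesis unfolding zero by (rule cfun.span_zero)
    qed
    then have "(\<Sum>k<n. (\<lambda>z. hardy_inner g (e k) * e k z)) \<in> cfun.span (e ` ?I)"
      by (intro cfun.span_sum) auto
    then show "g \<in> cfun.span (e ` ?I)" using orthonormal_expansion[OF e, of g] g(1) V by simp
  qed
  show "cfun.span (e ` ?I) \<subseteq> singular_space V T s"
  proof
    fix g assume g: "g \<in> cfun.span (e ` ?I)"
    have gV: "g \<in> V" using g cfun.span_mono[of "e ` ?I" "e ` {..<n}"] unfolding V by auto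
    have sgV: "(\<lambda>z. complex_of_real (s\<^sup>2) * g z) \<in> V" using gV unfolding V by (rule cfun.span_scale)
    have "hardy_inner g (e k) = 0" if k: "k < n" "\<mu> k \<noteq> s\<^sup>2" for k
    proof -
      have "hardy_inner (e k) h = 0" if "h \<in> e ` ?I" for h using e k that by (auto simp: orthonormal_def)
      then have "hardy_inner (e k) g = 0"
        using hardy_orthogonal_complement_span[OF _ eH[OF k(1)] _ g] eH by blast
      then show ?thesis using hardy_inner_commute[OF eH[OF k(1)], of g] gV VH by auto
    qed
    then have "hardy_inner (hardy_adjoint V T (T g)) (e k) =
        hardy_inner (\<lambda>z. complex_of_real (s\<^sup>2) * g z) (e k)" if "k < n" for k
      using inner[OF gV that] hardy_inner_scale_left[of g "e k"] gV VH eH[OF that] that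
      by (cases "\<mu> k = s\<^sup>2") auto
    then have "hardy_adjoint V T (T g) = (\<lambda>z. complex_of_real (s\<^sup>2) * g z)"
      using into[OF gV] sgV unfolding V by (intro orthonormal_eqI[OF e])
    then show "g \<in> singular_space V T s" using gV by (simp add: singular_space_def)
  qed
qed

lemma singular_values_eigenbasis:
  "singular_values V T = image_mset (\<lambda>k. sqrt (\<mu> k)) (mset_set {..<n})"
proof -
  define I where "I s = {k. k < n \<and> \<mu> k = s\<^sup>2}" for s
  have I: "I s = {k \<in> {..<n}. sqrt (\<mu> k) = s}" if "0 \<le> s" for s
    using that nonneg by (auto simp: I_def real_sqrt_unique)
  have dim: "cfun.dim (singular_space V T s) = card (I s)" for s
  proof -
    have "I s \<subseteq> {..<n}" by (auto simp: I_def)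
    from orthonormal_independent[OF e this] show ?thesis
      unfolding singular_space_eigenbasis I_def[symmetric]
      by (simp add: cfun.dim_eq_card_independent card_image)
  qed
  have "(\<exists>f\<in>singular_space V T s. f \<noteq> 0) \<longleftrightarrow> I s \<noteq> {}" for s
  proof
    assume "\<exists>f\<in>singular_space V T s. f \<noteq> 0"
    then show "I s \<noteq> {}" unfolding singular_space_eigenbasis I_def[symmetric] by auto
  next
    assume "I s \<noteq> {}"
    then obtain k where k: "k \<in> I s" by blast
    then have "hardy_inner (e k) (e k) = 1" using e by (auto simp: I_def orthonormal_def)
    then have "e k \<noteq> 0" by (metis hardy_inner_zero_left zero_neq_one)
    moreover have "e k \<in> singular_space V T s"
      unfolding singular_space_eigenbasis I_def[symmetric] using k by (intro cfun.span_base) auto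
    ultimately show "\<exists>f\<in>singular_space V T s. f \<noteq> 0" by blast
  qed
  then have "{s. 0 \<le> s \<and> (\<exists>f\<in>singular_space V T s. f \<noteq> 0)} = (\<lambda>k. sqrt (\<mu> k)) ` {..<n}"
    using nonneg by (auto simp: I_def intro!: rev_image_eqI)
  then show ?thesis
    unfolding singular_values_def image_mset_mset_set_conv_sum[OF finite_lessThan]
    using nonneg by (auto simp: dim I intro!: sum.cong)
qed

text \<open>For increasing \<open>\<mu>\<close> the list of roots is already sorted; reading it
  backwards gives the index \<open>n - 1 - k\<close>.\<close>

lemma singular_value_eigenbasis:
  assumes "\<And>i j. i \<le> j \<Longrightarrow> j < n \<Longrightarrow> \<mu> i \<le> \<mu> j" "k < n"
  shows "singular_value V T k = sqrt (\<mu> (n - 1 - k))"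
proof -
  have "mset (map (\<lambda>k. sqrt (\<mu> k)) [0..<n]) = image_mset (\<lambda>k. sqrt (\<mu> k)) (mset_set {..<n})"
    by (simp add: atLeast0LessThan)
  moreover have "sorted (map (\<lambda>k. sqrt (\<mu> k)) [0..<n])"
    using assms(1) by (auto simp: sorted_iff_nth_mono)
  ultimately have "sorted_list_of_multiset (singular_values V T) = map (\<lambda>k. sqrt (\<mu> k)) [0..<n]"
    unfolding singular_values_eigenbasis by (metis sorted_list_of_multiset_mset sorted_sort_id)
  then show ?thesis using assms(2) by (simp add: singular_value_def rev_nth)
qed

end

lemma sorted_reindexing:
  fixes w :: "nat \<Rightarrow> real"
  obtains p where "bij_betw p {..<n} {..<n}" "\<And>i j. i \<le> j \<Longrightarrow> j < n \<Longrightarrow> w (p j) \<le> w (p i)"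
proof -
  define xs where "xs = sort_key (\<lambda>k. - w k) [0..<n]"
  have xs: "distinct xs" "length xs = n" "set xs = {..<n}" "sorted (map (\<lambda>k. - w k) xs)"
    by (auto simp: xs_def)
  show thesis
  proof (rule that[of "(!) xs"])
    show "bij_betw ((!) xs) {..<n} {..<n}" using xs by (intro bij_betw_nth) auto
    show "w (xs ! j) \<le> w (xs ! i)" if "i \<le> j" "j < n" for i j
      using sorted_nth_mono[OF xs(4), of i j] that xs(2) by simp
  qed
qed

text \<open>Weyl's inequality and the numbering of the singular values both refer to eigenvalues in
  decreasing order.\<close>

corollary hardy_spectral_theorem_sorted:
  assumes "cfun_endomorphism V L" and "V \<subseteq> hardy_space" and "finite F" "V \<subseteq> cfun.span F"
    and "\<And>f g. f \<in> V \<Longrightarrow> g \<in> V \<Longrightarrow> hardy_inner (L f) g = hardy_inner f (L g)"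
  obtains n e \<mu> where "orthonormal n e" "V = cfun.span (e ` {..<n})"
    "\<And>i. i < n \<Longrightarrow> L (e i) = (\<lambda>z. complex_of_real (\<mu> i) * e i z)"
    "\<And>i j. i \<le> j \<Longrightarrow> j < n \<Longrightarrow> \<mu> j \<le> \<mu> i"
proof -
  obtain n e \<mu> where e: "orthonormal n e" "V = cfun.span (e ` {..<n})"
    "\<And>i. i < n \<Longrightarrow> L (e i) = (\<lambda>z. complex_of_real (\<mu> i) * e i z)"
    by (rule hardy_spectral_theorem[OF assms(1-4)], erule (1) assms(5), rule that)
  obtain p where p: "bij_betw p {..<n} {..<n}" "\<And>i j. i \<le> j \<Longrightarrow> j < n \<Longrightarrow> \<mu> (p j) \<le> \<mu> (p i)"
    using sorted_reindexing by blast
  have lt: "p i < n" if "i < n" for i using p(1) that by (auto dest: bij_betwE)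
  have inj: "p i = p j \<longleftrightarrow> i = j" if "i < n" "j < n" for i j
    using p(1) that by (auto simp: bij_betw_def inj_on_def)
  show thesis
  proof (rule that[of n "e \<circ> p" "\<mu> \<circ> p"])
    show "orthonormal n (e \<circ> p)" using e(1) by (simp add: orthonormal_def lt inj)
    show "V = cfun.span ((e \<circ> p) ` {..<n})"
      unfolding image_comp[symmetric] bij_betw_imp_surj_on[OF p(1)] by (rule e(2))
  qed (use e(3) lt p(2) in auto)
qed

section \<open>Blaschke products and kernels\<close>

lemma szego_denominator_nonzero:
  assumes "w \<in> ball 0 1" "z \<in> ball 0 1"
  shows "1 - cnj w * z \<noteq> 0" "1 - z * cnj w \<noteq> 0"
proof -
  have "cmod (cnj w * z) < 1"
    using assms mult_strict_mono'[of "cmod w" 1 "cmod z" 1] by (simp add: norm_mult)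
  then show "1 - cnj w * z \<noteq> 0" by (metis eq_iff_diff_eq_0 norm_one less_irrefl)
  then show "1 - z * cnj w \<noteq> 0" by (simp add: mult.commute)
qed

lemma blaschke_factor_eq_0_iff:
  assumes "a \<in> ball 0 1" "z \<in> ball 0 1"
  shows "blaschke_factor a z = 0 \<longleftrightarrow> z = a"
  using szego_denominator_nonzero[OF assms] by (auto simp: blaschke_factor_def)

text \<open>The numerator of \<open>1 - cnj (blaschke_factor a w) * blaschke_factor a z\<close>
  contains \<open>1 - cnj w * z\<close>, which cancels the denominator of the kernel at
  \<open>w\<close> and leaves a multiple of the kernel at \<open>a\<close>.\<close>

lemma blaschke_factor_defect:
  assumes "a \<in> ball 0 1" "w \<in> ball 0 1" "z \<in> ball 0 1"
  shows "szego_kernel w z * (1 - cnj (blaschke_factor a w) * blaschke_factor a z) =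
    (1 - cnj a * a) / (1 - a * cnj w) * szego_kernel a z"
proof (cases "a = 0")
  case True
  then show ?thesis
    using assms szego_denominator_nonzero[of w z] by (simp add: blaschke_factor_def szego_kernel_def)
next
  case False
  \<comment> \<open>The unimodular constant of the Blaschke factor cancels against its
    conjugate.\<close>
  define u where "u = cnj a / of_real (cmod a)"
  have u: "cnj u * u = 1"
    using False complex_norm_square[of a]
    by (simp add: u_def divide_simps power2_eq_square mult.commute)
  note nz = szego_denominator_nonzero[of w z] szego_denominator_nonzero[of a z]
    szego_denominator_nonzero[of w a]
  have "1 - cnj (blaschke_factor a w) * blaschke_factor a z =
      1 - cnj u * u * ((cnj a - cnj w) / (1 - a * cnj w) * ((a - z) / (1 - cnj a * z)))"
    using False by (simp add: blaschke_factor_def u_def mult_ac)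
  also have "\<dots> = (1 - cnj a * a) * (1 - cnj w * z) / ((1 - a * cnj w) * (1 - cnj a * z))"
    unfolding u using assms nz by (simp add: divide_simps) (simp add: algebra_simps)
  finally show ?thesis using assms nz by (simp add: szego_kernel_def)
qed

lemma blaschke_product_insert:
  assumes "finite A" "c \<notin> A"
  shows "blaschke_product (insert c A) z = blaschke_factor c z * blaschke_product A z"
  using assms by (simp add: blaschke_product_def)

lemma blaschke_product_eq_0_iff:
  assumes "finite A" "A \<subseteq> ball 0 1" "z \<in> ball 0 1"
  shows "blaschke_product A z = 0 \<longleftrightarrow> z \<in> A"
  using assms blaschke_factor_eq_0_iff[of _ z] by (auto simp: blaschke_product_def subset_iff)

lemma kernel_span_mono: "S \<subseteq> S' \<Longrightarrow> kernel_span S \<subseteq> kernel_span S'"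
  unfolding kernel_span_def by (intro cfun.span_mono) auto

lemma subspace_kernel_span: "cfun.subspace (kernel_span S)"
  unfolding kernel_span_def by (rule cfun.subspace_span)

lemma szego_kernel_in_kernel_span: "w \<in> S \<Longrightarrow> szego_kernel w \<in> kernel_span S"
  unfolding kernel_span_def by (intro cfun.span_base) auto

text \<open>\<open>B\<^sub>A k\<^sub>w\<close> times the conjugate of \<open>B\<^sub>A(w)\<close> is the projection of \<open>k\<^sub>w\<close> to \<open>B\<^sub>A H\<^sup>2\<close>.\<close>

lemma blaschke_defect_in_kernel_span:
  assumes "finite A" "A \<subseteq> ball 0 1" "w \<in> ball 0 1"
  shows "szego_kernel w - (\<lambda>z. cnj (blaschke_product A w) * (blaschke_product A z * szego_kernel w z))
    \<in> kernel_span A"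
  using assms
proof (induction A arbitrary: w rule: finite_induct)
  case empty
  have zero: "szego_kernel w - (\<lambda>z. cnj (blaschke_product {} w) *
      (blaschke_product {} z * szego_kernel w z)) = 0"
    by (simp add: blaschke_product_def fun_eq_iff)
  show ?case unfolding zero by (rule cfun.subspace_0[OF subspace_kernel_span])
next
  case (insert c A)
  define D where "D w = szego_kernel w -
    (\<lambda>z. cnj (blaschke_product A w) * (blaschke_product A z * szego_kernel w z))" for w
  have mono: "kernel_span A \<subseteq> kernel_span (insert c A)" by (rule kernel_span_mono) auto
  have c: "c \<in> ball 0 1" "A \<subseteq> ball 0 1" using insert.prems by auto
  have D: "D w \<in> kernel_span (insert c A)" "D c \<in> kernel_span (insert c A)"
    unfolding D_def by (rule subsetD[OF mono insert.IH[OF c(2) insert.prems(2)]],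
      rule subsetD[OF mono insert.IH[OF c(2,1)]])
  have Bc: "blaschke_product A c \<noteq> 0"
    using blaschke_product_eq_0_iff[OF insert(1) c(2,1)] insert(2) by simp
  \<comment> \<open>By \<open>blaschke_factor_defect\<close>, the new factor adds to
    \<open>D w\<close> a multiple of \<open>B\<^sub>A k\<^sub>c\<close>. This lies in the span
    because \<open>k\<^sub>c - D c\<close> is \<open>B\<^sub>A k\<^sub>c\<close> times the conjugate
    of \<open>B\<^sub>A(c)\<close>, which is nonzero and can be divided out.\<close>
  define \<kappa> where "\<kappa> = cnj (blaschke_product A w) * ((1 - cnj c * c) / (1 - c * cnj w)) /
      cnj (blaschke_product A c)"
  have eq: "szego_kernel w - (\<lambda>z. cnj (blaschke_product (insert c A) w) *
        (blaschke_product (insert c A) z * szego_kernel w z)) =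
      D w + (\<lambda>z. \<kappa> * (szego_kernel c - D c) z)"
  proof
    fix z
    show "(szego_kernel w - (\<lambda>z. cnj (blaschke_product (insert c A) w) *
        (blaschke_product (insert c A) z * szego_kernel w z))) z =
      (D w + (\<lambda>z. \<kappa> * (szego_kernel c - D c) z)) z"
    proof (cases "z \<in> ball 0 1")
      case False
      then show ?thesis by (simp add: D_def szego_kernel_def)
    next
      case True
      have "(szego_kernel w - (\<lambda>z. cnj (blaschke_product (insert c A) w) *
          (blaschke_product (insert c A) z * szego_kernel w z))) z =
        D w z + cnj (blaschke_product A w) * blaschke_product A z *
          (szego_kernel w z * (1 - cnj (blaschke_factor c w) * blaschke_factor c z))"
        using insert(1,2) by (simp add: blaschke_product_insert D_def algebra_simps)
      also have "\<dots> = D w z + \<kappa> * (szego_kernel c - D c) z"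
        unfolding blaschke_factor_defect[OF c(1) insert.prems(2) True]
        using Bc by (simp add: \<kappa>_def D_def)
      finally show ?thesis by simp
    qed
  qed
  note S = subspace_kernel_span[of "insert c A"]
  show ?case
    unfolding eq
    by (rule cfun.subspace_add[OF S D(1) cfun.subspace_scale[OF S
      cfun.subspace_diff[OF S szego_kernel_in_kernel_span[OF insertI1] D(2)]]])
qed

text \<open>By the reproducing property, the inner product with a kernel at a point of
  \<open>A\<close> is the value there.\<close>

lemma hardy_inner_kernel_span_vanishing:
  assumes "A \<subseteq> ball 0 1" "f \<in> hardy_space" "\<And>a. a \<in> A \<Longrightarrow> f a = 0" "h \<in> kernel_span A"
  shows "hardy_inner f h = 0" "hardy_inner h f = 0"
proof -
  show *: "hardy_inner f h = 0"
  proof (rule hardy_orthogonal_complement_span)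
    show "szego_kernel ` A \<subseteq> hardy_space" using assms(1) szego_kernel_in_hardy_space by auto
    show "h \<in> cfun.span (szego_kernel ` A)" using assms(4) by (simp add: kernel_span_def)
    show "hardy_inner f g = 0" if "g \<in> szego_kernel ` A" for g
      using that assms szego_kernel_reproducing[OF assms(2)] by auto
  qed (rule assms)
  have "h \<in> hardy_space" using kernel_span_subset_hardy_space assms by blast
  then show "hardy_inner h f = 0" using * hardy_inner_commute[OF assms(2), of h] by simp
qed

text \<open>Otherwise \<open>g\<close>, the part of the kernel divisible by
  \<open>B\<^sub>A\<close>, would be in the span as well. Vanishing on \<open>A\<close>, it would be
  orthogonal to itself, but it is nonzero at \<open>c\<close>.\<close>

lemma szego_kernel_not_in_kernel_span:
  assumes "finite A" "A \<subseteq> ball 0 1" "c \<in> ball 0 1" "c \<notin> A"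
  shows "szego_kernel c \<notin> kernel_span A"
proof
  assume c: "szego_kernel c \<in> kernel_span A"
  define g where "g = (\<lambda>z. cnj (blaschke_product A c) * (blaschke_product A z * szego_kernel c z))"
  have "szego_kernel c - (szego_kernel c - g) \<in> kernel_span A"
    using blaschke_defect_in_kernel_span[OF assms(1,2,3)] c
    unfolding g_def[symmetric] by (rule cfun.subspace_diff[OF subspace_kernel_span, rotated])
  moreover have "szego_kernel c - (szego_kernel c - g) = g" by (simp add: fun_eq_iff)
  ultimately have g: "g \<in> kernel_span A" by (rule back_subst[where P = "\<lambda>f. f \<in> kernel_span A"])
  then have "g \<in> hardy_space" using kernel_span_subset_hardy_space[OF assms(2)] by auto
  moreover have "g a = 0" if "a \<in> A" for a
    using blaschke_product_eq_0_iff[OF assms(1,2), of a] that assms(2) by (auto simp: g_def)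
  ultimately have "g = 0"
    using hardy_inner_kernel_span_vanishing(1)[OF assms(2) _ _ g, of g] hardy_inner_eq_0 by blast
  then have "g c = 0" by simp
  then show False
    using blaschke_product_eq_0_iff[OF assms(1,2,3)] assms(3,4) szego_denominator_nonzero[of c c]
    by (auto simp: g_def szego_kernel_def)
qed

lemma szego_kernels_independent:
  assumes "finite A" "A \<subseteq> ball 0 1"
  shows "cfun.independent (szego_kernel ` A)" "inj_on szego_kernel A"
proof -
  show "cfun.independent (szego_kernel ` A)"
    using assms
  proof (induction A rule: finite_induct)
    case (insert c A)
    then show ?case
      using szego_kernel_not_in_kernel_span[of A c]
      by (simp add: kernel_span_def cfun.independent_insertI)
  qed (simp add: cfun.independent_empty)
  show "inj_on szego_kernel A"
  proof (rule inj_onI)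
    fix c d assume *: "c \<in> A" "d \<in> A" "szego_kernel c = szego_kernel d"
    have "szego_kernel d \<in> kernel_span {c}"
      using szego_kernel_in_kernel_span[of c "{c}"] *(3) by simp
    then have "d \<in> {c}"
      using szego_kernel_not_in_kernel_span[of "{c}" d] *(1,2) assms(2) by blast
    then show "c = d" by simp
  qed
qed

text \<open>A function in the span of \<open>card C\<close> kernels is a polynomial of degree less than
  \<open>card C\<close> divided by a product of \<open>card C\<close> factors.\<close>

lemma kernel_span_vanishing_imp_zero:
  assumes "finite A" "finite C" "A \<subseteq> ball 0 1" "C \<subseteq> ball 0 1" "card C \<le> card A"
    and f: "f \<in> kernel_span C" "\<And>a. a \<in> A \<Longrightarrow> f a = 0"
  shows "f = 0"
proof -
  \<comment> \<open>Bounding the degree through the coefficients admits \<open>p = 0\<close> even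
    for empty \<open>C\<close> and is closed under linear combinations.\<close>
  define W where "W = {f. \<exists>p. (\<forall>i\<ge>card C. coeff p i = 0) \<and>
    (\<forall>z\<in>ball 0 1. f z * (\<Prod>c\<in>C. 1 - cnj c * z) = poly p z)}"
  have "cfun.subspace W"
  proof (rule cfun.subspaceI)
    show "0 \<in> W" unfolding W_def by (auto intro!: exI[of _ 0])
  next
    fix f g assume "f \<in> W" "g \<in> W"
    then obtain p q where "\<forall>i\<ge>card C. coeff p i = 0" "\<forall>i\<ge>card C. coeff q i = 0"
      "\<forall>z\<in>ball 0 1. f z * (\<Prod>c\<in>C. 1 - cnj c * z) = poly p z"
      "\<forall>z\<in>ball 0 1. g z * (\<Prod>c\<in>C. 1 - cnj c * z) = poly q z"
      unfolding W_def by blast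
    then show "f + g \<in> W" unfolding W_def by (auto intro!: exI[of _ "p + q"] simp: distrib_right)
  next
    fix c f assume "f \<in> W"
    then obtain p where "\<forall>i\<ge>card C. coeff p i = 0"
      "\<forall>z\<in>ball 0 1. f z * (\<Prod>c\<in>C. 1 - cnj c * z) = poly p z"
      unfolding W_def by blast
    then show "(\<lambda>z. c * f z) \<in> W" unfolding W_def by (auto intro!: exI[of _ "Polynomial.smult c p"])
  qed
  moreover have "szego_kernel d \<in> W" if d: "d \<in> C" for d
  proof -
    define p where "p = (\<Prod>c\<in>C - {d}. [:1, - cnj c:])"
    have "degree p \<le> (\<Sum>c\<in>C - {d}. degree [:1, - cnj c:])"
      using degree_prod_sum_le[of "C - {d}" "\<lambda>c. [:1, - cnj c:]"] assms(2) by (simp add: p_def o_def)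
    also have "\<dots> \<le> (\<Sum>c\<in>C - {d}. 1)" by (intro sum_mono) (simp add: degree_pCons_le)
    also have "\<dots> < card C" using d assms(2) card_Diff1_less[of C d] by simp
    finally have "degree p < card C" .
    moreover have "szego_kernel d z * (\<Prod>c\<in>C. 1 - cnj c * z) = poly p z" if z: "z \<in> ball 0 1" for z
    proof -
      have "1 - cnj d * z \<noteq> 0" using szego_denominator_nonzero z d assms(4) by blast
      then show ?thesis
        using z prod.remove[OF assms(2) d, of "\<lambda>c. 1 - cnj c * z"]
        by (simp add: szego_kernel_def p_def poly_prod mult.commute)
    qed
    ultimately show ?thesis unfolding W_def by (auto intro!: exI[of _ p] coeff_eq_0)
  qed
  ultimately have "kernel_span C \<subseteq> W" unfolding kernel_span_def by (intro cfun.span_minimal) auto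
  then obtain p where p: "\<And>i. i \<ge> card C \<Longrightarrow> coeff p i = 0"
    "\<And>z. z \<in> ball 0 1 \<Longrightarrow> f z * (\<Prod>c\<in>C. 1 - cnj c * z) = poly p z"
    using f(1) unfolding W_def by blast
  have "p = 0"
  proof (rule ccontr)
    assume "p \<noteq> 0"
    have "A \<subseteq> {z. poly p z = 0}"
    proof
      fix a assume "a \<in> A"
      then show "a \<in> {z. poly p z = 0}" using p(2)[of a] f(2)[of a] assms(3) by auto
    qed
    \<comment> \<open>A nonzero \<open>p\<close> has degree less than \<open>card C\<close>, too
      small for \<open>card A\<close> roots.\<close>
    then have "card A \<le> degree p"
      using card_poly_roots_bound[OF \<open>p \<noteq> 0\<close>] card_mono[OF poly_roots_finite[OF \<open>p \<noteq> 0\<close>], of A] by simp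
    then have "coeff p (degree p) = 0" using p(1) assms(5) by simp
    then show False using \<open>p \<noteq> 0\<close> by simp
  qed
  show "f = 0"
  proof
    fix z show "f z = 0 z"
    proof (cases "z \<in> ball 0 1")
      case True
      then have "(\<Prod>c\<in>C. 1 - cnj c * z) \<noteq> 0"
        using szego_denominator_nonzero(1) assms(2,4) by (subst prod_zero_iff) blast+
      then show ?thesis using p(2)[OF True] \<open>p = 0\<close> by simp
    next
      case False
      then show ?thesis
        using f(1) kernel_span_subset_hardy_space[OF assms(4)] by (auto simp: hardy_space_def)
    qed
  qed
qed

section \<open>Projections to vanishing subspaces\<close>

text \<open>Used with \<open>S\<close> the union of the two node sets and \<open>A\<close> one of
  them. Inside \<open>kernel_span S\<close>, the functions vanishing on \<open>A\<close> and the
  span of the kernels at \<open>A\<close> turn out to be orthogonal complements.\<close>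

locale disk_subset =
  fixes S A :: "complex set"
  assumes finite: "finite S" and disk: "S \<subseteq> ball 0 1" and subset: "A \<subseteq> S"
begin

abbreviation proj :: "(complex \<Rightarrow> complex) \<Rightarrow> complex \<Rightarrow> complex" where
  "proj \<equiv> orth_proj (vanishing_subspace S A)"

lemma finite_A: "finite A" and disk_A: "A \<subseteq> ball 0 1"
  using finite disk subset finite_subset by auto

lemma kernel_span_hardy: "f \<in> kernel_span S \<Longrightarrow> f \<in> hardy_space"
  using kernel_span_subset_hardy_space[OF disk] by blast

lemma kernel_span_A: "f \<in> kernel_span A \<Longrightarrow> f \<in> kernel_span S"
  using kernel_span_mono[OF subset] by blast

lemma subspace_vanishing: "cfun.subspace (vanishing_subspace S A)"
  unfolding vanishing_subspace_def
  by (rule cfun.subspaceI)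
     (auto simp: cfun.subspace_0 cfun.subspace_add cfun.subspace_scale subspace_kernel_span)

lemma vanishing_kernel_span: "f \<in> vanishing_subspace S A \<Longrightarrow> f \<in> kernel_span S"
  by (simp add: vanishing_subspace_def)

lemma inner_vanishing:
  assumes "f \<in> vanishing_subspace S A" "h \<in> kernel_span A"
  shows "hardy_inner f h = 0" "hardy_inner h f = 0"
  using hardy_inner_kernel_span_vanishing[OF disk_A kernel_span_hardy _ assms(2), of f] assms(1)
  by (auto simp: vanishing_subspace_def)

text \<open>The kernels at \<open>A\<close> are orthogonal to the functions vanishing on
  \<open>A\<close>, so a decomposition of \<open>f\<close> along these two subspaces determines the
  \<open>THE\<close> in \<open>orth_proj\<close>.\<close>

lemma proj_eqI:
  assumes g: "g \<in> vanishing_subspace S A" and fg: "f - g \<in> kernel_span A"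
  shows "proj f = g"
  unfolding orth_proj_def
proof (rule the_equality)
  show "g \<in> vanishing_subspace S A \<and> (\<forall>h\<in>vanishing_subspace S A. hardy_inner (f - g) h = 0)"
    using g fg inner_vanishing(2) by blast
next
  fix g' assume g': "g' \<in> vanishing_subspace S A \<and> (\<forall>h\<in>vanishing_subspace S A. hardy_inner (f - g') h = 0)"
  define d where "d = g' - g"
  have d: "d \<in> vanishing_subspace S A"
    unfolding d_def using g g' by (intro cfun.subspace_diff[OF subspace_vanishing]) auto
  have hardy: "f - g \<in> hardy_space" "d \<in> hardy_space"
    using fg d kernel_span_A vanishing_kernel_span kernel_span_hardy by auto
  have eq: "f - g' = (f - g) - d" by (simp add: d_def fun_eq_iff)
  have "hardy_inner ((f - g) - d) d = 0" using g' d unfolding eq[symmetric] by blast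
  then have "hardy_inner d d = 0"
    using inner_vanishing(2)[OF d fg] hardy hardy_inner_diff_left[OF hardy hardy(2)] by simp
  then have "d = 0" using hardy_inner_eq_0 hardy by blast
  then show "g' = g" unfolding d_def by simp
qed

text \<open>The summand \<open>g\<close> has the factor \<open>B\<^sub>A\<close>, so it vanishes on
  \<open>A\<close>; it lies in \<open>kernel_span S\<close> because the kernel and the Blaschke
  defect do.\<close>

lemma szego_kernel_decomposition:
  assumes "w \<in> S"
  defines "g \<equiv> (\<lambda>z. cnj (blaschke_product A w) * (blaschke_product A z * szego_kernel w z))"
  shows "g \<in> vanishing_subspace S A" "szego_kernel w - g \<in> kernel_span A"
proof -
  have "w \<in> ball 0 1" using assms disk by auto
  from blaschke_defect_in_kernel_span[OF finite_A disk_A this]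
  show d: "szego_kernel w - g \<in> kernel_span A" by (simp add: g_def)
  have eq: "szego_kernel w - (szego_kernel w - g) = g" by (simp add: fun_eq_iff)
  have "g \<in> kernel_span S"
    by (rule cfun.subspace_diff[OF subspace_kernel_span
        szego_kernel_in_kernel_span[OF assms(1)] kernel_span_A[OF d], unfolded eq])
  moreover have "g a = 0" if "a \<in> A" for a
    using blaschke_product_eq_0_iff[OF finite_A disk_A, of a] that disk_A by (auto simp: g_def)
  ultimately show "g \<in> vanishing_subspace S A" by (auto simp: vanishing_subspace_def)
qed

text \<open>The functions with such a decomposition form a subspace, and it contains all the
  kernels.\<close>

lemma proj_exists:
  assumes "f \<in> kernel_span S"
  shows "\<exists>g\<in>vanishing_subspace S A. f - g \<in> kernel_span A"
proof -
  let ?Z = "vanishing_subspace S A"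
  have "cfun.subspace {f. \<exists>g\<in>?Z. f - g \<in> kernel_span A}" (is "cfun.subspace ?W")
  proof (rule cfun.subspaceI)
    show "0 \<in> ?W"
      using cfun.subspace_0[OF subspace_vanishing] cfun.subspace_0[OF subspace_kernel_span] by force
  next
    fix f f' assume "f \<in> ?W" "f' \<in> ?W"
    then obtain g g' where g: "g \<in> ?Z" "g' \<in> ?Z" "f - g \<in> kernel_span A" "f' - g' \<in> kernel_span A"
      by blast
    have eq: "(f - g) + (f' - g') = f + f' - (g + g')" by (simp add: fun_eq_iff)
    show "f + f' \<in> ?W"
      using cfun.subspace_add[OF subspace_kernel_span g(3,4), unfolded eq]
        cfun.subspace_add[OF subspace_vanishing g(1,2)] by blast
  next
    fix c f assume "f \<in> ?W"
    then obtain g where g: "g \<in> ?Z" "f - g \<in> kernel_span A" by blast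
    have eq: "(\<lambda>z. c * f z) - (\<lambda>z. c * g z) = (\<lambda>z. c * (f - g) z)"
      by (simp add: fun_eq_iff right_diff_distrib)
    show "(\<lambda>z. c * f z) \<in> ?W"
      using cfun.subspace_scale[OF subspace_kernel_span g(2), of c, folded eq]
        cfun.subspace_scale[OF subspace_vanishing g(1), of c] by blast
  qed
  moreover have "szego_kernel w \<in> ?W" if "w \<in> S" for w
    using szego_kernel_decomposition[OF that] by blast
  ultimately have "kernel_span S \<subseteq> ?W"
    unfolding kernel_span_def by (intro cfun.span_minimal) (auto simp: kernel_span_def)
  then show ?thesis using assms by blast
qed

lemma proj_in:
  assumes "f \<in> kernel_span S"
  shows "proj f \<in> vanishing_subspace S A" "f - proj f \<in> kernel_span A" "proj f \<in> kernel_span S"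
  using proj_exists[OF assms] proj_eqI vanishing_kernel_span by auto

lemma proj_vanishing: "f \<in> vanishing_subspace S A \<Longrightarrow> proj f = f"
  using cfun.subspace_0[OF subspace_kernel_span] by (intro proj_eqI) auto

lemma proj_add:
  assumes "f \<in> kernel_span S" "g \<in> kernel_span S"
  shows "proj (f + g) = proj f + proj g"
proof (rule proj_eqI)
  show "proj f + proj g \<in> vanishing_subspace S A"
    by (rule cfun.subspace_add[OF subspace_vanishing proj_in(1)[OF assms(1)] proj_in(1)[OF assms(2)]])
  have eq: "f + g - (proj f + proj g) = (f - proj f) + (g - proj g)" by (simp add: fun_eq_iff)
  show "f + g - (proj f + proj g) \<in> kernel_span A"
    unfolding eq by (rule cfun.subspace_add[OF subspace_kernel_span proj_in(2)[OF assms(1)] proj_in(2)[OF assms(2)]])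
qed

lemma proj_scale:
  assumes "f \<in> kernel_span S"
  shows "proj (\<lambda>z. c * f z) = (\<lambda>z. c * proj f z)"
proof (rule proj_eqI)
  show "(\<lambda>z. c * proj f z) \<in> vanishing_subspace S A"
    by (rule cfun.subspace_scale[OF subspace_vanishing proj_in(1)[OF assms]])
  have eq: "(\<lambda>z. c * f z) - (\<lambda>z. c * proj f z) = (\<lambda>z. c * (f - proj f) z)"
    by (simp add: fun_eq_iff right_diff_distrib)
  show "(\<lambda>z. c * f z) - (\<lambda>z. c * proj f z) \<in> kernel_span A"
    unfolding eq by (rule cfun.subspace_scale[OF subspace_kernel_span proj_in(2)[OF assms]])
qed

lemma proj_diff:
  assumes "f \<in> kernel_span S" "g \<in> kernel_span S"
  shows "proj (f - g) = proj f - proj g"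
  using proj_add[OF cfun.subspace_diff[OF subspace_kernel_span assms] assms(2)]
  by (simp add: fun_eq_iff)

lemma proj_inner:
  assumes f: "f \<in> kernel_span S" and g: "g \<in> vanishing_subspace S A"
  shows "hardy_inner (proj f) g = hardy_inner f g" "hardy_inner g (proj f) = hardy_inner g f"
  using inner_vanishing[OF g proj_in(2)[OF f]]
    hardy_inner_diff_left[of f "proj f" g] hardy_inner_diff_right[of f "proj f" g]
    kernel_span_hardy f proj_in(3)[OF f] vanishing_kernel_span[OF g]
  by auto

lemma proj_self_adjoint:
  assumes "f \<in> kernel_span S" "g \<in> kernel_span S"
  shows "hardy_inner (proj f) g = hardy_inner f (proj g)"
  using proj_inner(1)[OF assms(1) proj_in(1)[OF assms(2)]] proj_inner(2)[OF assms(2) proj_in(1)[OF assms(1)]]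
  by simp

lemma proj_szego_kernel:
  assumes "w \<in> S"
  shows "proj (szego_kernel w) z = cnj (blaschke_product A w) * (blaschke_product A z * szego_kernel w z)"
  by (subst proj_eqI[OF szego_kernel_decomposition[OF assms]]) (rule refl)

end

section \<open>A pair of node sets\<close>

text \<open>Equal cardinality forces a function to be zero if it lies in the span of the kernels at
  one set and vanishes on the other.\<close>

locale kernel_pair =
  fixes A B :: "complex set"
  assumes finite: "finite A" "finite B" and disk: "A \<subseteq> ball 0 1" "B \<subseteq> ball 0 1"
    and card: "card A = card B"
begin

sublocale za: disk_subset "A \<union> B" A
  by unfold_locales (use finite disk in auto)

sublocale zb: disk_subset "A \<union> B" B
  by unfold_locales (use finite disk in auto)

abbreviation Zb where "Zb \<equiv> vanishing_subspace (A \<union> B) B"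

definition compression :: "(complex \<Rightarrow> complex) \<Rightarrow> complex \<Rightarrow> complex" where
  "compression f = za.proj f - zb.proj (za.proj f)"

lemma compression_in: "f \<in> kernel_span (A \<union> B) \<Longrightarrow> compression f \<in> kernel_span B"
  unfolding compression_def by (intro zb.proj_in za.proj_in)

text \<open>The subtracted part lies in \<open>Zb\<close> and is therefore orthogonal to
  \<open>g\<close>.\<close>

lemma compression_inner:
  assumes "f \<in> kernel_span (A \<union> B)" "g \<in> kernel_span B"
  shows "hardy_inner (compression f) g = hardy_inner (za.proj f) g"
    "hardy_inner g (compression f) = hardy_inner g (za.proj f)"
proof -
  have Pf: "za.proj f \<in> kernel_span (A \<union> B)" by (rule za.proj_in(3)[OF assms(1)])
  note Q = zb.proj_in[OF Pf]
  have hardy: "za.proj f \<in> hardy_space" "zb.proj (za.proj f) \<in> hardy_space" "g \<in> hardy_space"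
    using Pf Q(3) zb.kernel_span_A[OF assms(2)] za.kernel_span_hardy by auto
  show "hardy_inner (compression f) g = hardy_inner (za.proj f) g"
    unfolding compression_def hardy_inner_diff_left[OF hardy]
    by (simp add: zb.inner_vanishing(1)[OF Q(1) assms(2)])
  show "hardy_inner g (compression f) = hardy_inner g (za.proj f)"
    unfolding compression_def hardy_inner_diff_right[OF hardy]
    by (simp add: zb.inner_vanishing(2)[OF Q(1) assms(2)])
qed

lemma compression_self_adjoint:
  assumes "f \<in> kernel_span B" "g \<in> kernel_span B"
  shows "hardy_inner (compression f) g = hardy_inner f (compression g)"
  using compression_inner[OF zb.kernel_span_A[OF assms(1)] assms(2)]
    compression_inner[OF zb.kernel_span_A[OF assms(2)] assms(1)]
    za.proj_self_adjoint[OF zb.kernel_span_A[OF assms(1)] zb.kernel_span_A[OF assms(2)]]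
  by simp

lemma compression_endomorphism: "cfun_endomorphism (kernel_span B) compression"
proof
  show "cfun.subspace (kernel_span B)" by (rule subspace_kernel_span)
  fix f assume "f \<in> kernel_span B"
  then have f: "f \<in> kernel_span (A \<union> B)" by (rule zb.kernel_span_A)
  show "compression f \<in> kernel_span B" by (rule compression_in[OF f])
  show "compression (\<lambda>z. c * f z) = (\<lambda>z. c * compression f z)" for c
    unfolding compression_def za.proj_scale[OF f] zb.proj_scale[OF za.proj_in(3)[OF f]]
    by (simp add: fun_eq_iff right_diff_distrib)
  fix g assume "g \<in> kernel_span B"
  then have g: "g \<in> kernel_span (A \<union> B)" by (rule zb.kernel_span_A)
  show "compression (f + g) = compression f + compression g"
    unfolding compression_def za.proj_add[OF f g] zb.proj_add[OF za.proj_in(3)[OF f] za.proj_in(3)[OF g]]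
    by (simp add: fun_eq_iff)
qed

text \<open>Write \<open>P\<close> and \<open>Q\<close> for \<open>za.proj\<close> and
  \<open>zb.proj\<close>. For \<open>f\<close> and \<open>g\<close> in \<open>Zb\<close>,
  \<open><P Q f, P Q g> = <P f, P g> = <f, P g> = <f, Q P g>\<close>, and \<open>Q P g\<close> is in
  \<open>Zb\<close>.\<close>

lemma hardy_adjoint_proj:
  assumes g: "g \<in> Zb"
  shows "hardy_adjoint Zb (\<lambda>f. za.proj (zb.proj f)) (za.proj (zb.proj g)) = zb.proj (za.proj g)"
proof -
  have gS: "g \<in> kernel_span (A \<union> B)" by (rule zb.vanishing_kernel_span[OF g])
  note Pg = za.proj_in[OF gS]
  have h: "zb.proj (za.proj g) \<in> Zb" by (rule zb.proj_in(1)[OF Pg(3)])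
  have inner: "hardy_inner (za.proj (zb.proj f)) (za.proj g) = hardy_inner f (zb.proj (za.proj g))"
    if f: "f \<in> Zb" for f
  proof -
    have fS: "f \<in> kernel_span (A \<union> B)" by (rule zb.vanishing_kernel_span[OF f])
    show ?thesis
      unfolding zb.proj_vanishing[OF f] za.proj_inner(1)[OF fS Pg(1)] zb.proj_inner(2)[OF Pg(3) f] ..
  qed
  show ?thesis
    unfolding hardy_adjoint_def zb.proj_vanishing[OF g]
  proof (rule the_equality)
    show "zb.proj (za.proj g) \<in> Zb \<and> (\<forall>f\<in>Zb. hardy_inner (za.proj (zb.proj f)) (za.proj g) =
        hardy_inner f (zb.proj (za.proj g)))"
      using h inner by blast
    fix h' assume h': "h' \<in> Zb \<and> (\<forall>f\<in>Zb. hardy_inner (za.proj (zb.proj f)) (za.proj g) = hardy_inner f h')"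
    define d where "d = h' - zb.proj (za.proj g)"
    have d: "d \<in> Zb"
      unfolding d_def using h h' by (intro cfun.subspace_diff[OF zb.subspace_vanishing]) auto
    have hardy: "h' \<in> hardy_space" "zb.proj (za.proj g) \<in> hardy_space" "d \<in> hardy_space"
      using h h' d zb.vanishing_kernel_span zb.kernel_span_hardy by auto
    have "hardy_inner d d = hardy_inner d h' - hardy_inner d (zb.proj (za.proj g))"
      using hardy_inner_diff_right[OF hardy] by (simp only: d_def)
    also have "\<dots> = 0" using h' d inner[OF d] by simp
    finally have "d = 0" by (rule hardy_inner_eq_0[OF hardy(3)])
    then show "h' = zb.proj (za.proj g)" unfolding d_def by simp
  qed
qed

section \<open>Transporting an eigenbasis of the compression to \<open>Zb\<close>\<close>

context
  fixes n :: nat and e :: "nat \<Rightarrow> complex \<Rightarrow> complex" and \<nu> :: "nat \<Rightarrow> real"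
  assumes e: "orthonormal n e" and span: "kernel_span B = cfun.span (e ` {..<n})"
    and eigen: "\<And>k. k < n \<Longrightarrow> compression (e k) = (\<lambda>z. complex_of_real (\<nu> k) * e k z)"
begin

lemma eigenvector_in: "k < n \<Longrightarrow> e k \<in> kernel_span B" "k < n \<Longrightarrow> e k \<in> kernel_span (A \<union> B)"
  and eigenvector_hardy: "k < n \<Longrightarrow> e k \<in> hardy_space"
proof -
  assume "k < n"
  then show *: "e k \<in> kernel_span B" unfolding span by (intro cfun.span_base) auto
  then show "e k \<in> kernel_span (A \<union> B)" by (rule zb.kernel_span_A)
  show "e k \<in> hardy_space" using e \<open>k < n\<close> by (simp add: orthonormal_def)
qed

lemma inner_proj_eigenvector:
  assumes "k < n" "l < n"
  shows "hardy_inner (za.proj (e k)) (e l) = (if k = l then complex_of_real (\<nu> k) else 0)"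
proof -
  have "hardy_inner (za.proj (e k)) (e l) = hardy_inner (compression (e k)) (e l)"
    by (rule compression_inner(1)[symmetric, OF eigenvector_in(2) eigenvector_in(1)]) (rule assms)+
  also have "\<dots> = of_real (\<nu> k) * hardy_inner (e k) (e l)"
    unfolding eigen[OF assms(1)]
    by (rule hardy_inner_scale_left[OF eigenvector_hardy eigenvector_hardy]) (rule assms)+
  finally show ?thesis using e assms by (simp add: orthonormal_def)
qed

text \<open>The squared norm of \<open>e k - za.proj (e k)\<close> is \<open>1 - \<nu> k\<close>. If
  it were zero, \<open>e k\<close> would vanish on \<open>A\<close> while lying in the span of the
  kernels at \<open>B\<close>, hence be zero.\<close>

lemma eigenvalue_less_1:
  assumes k: "k < n"
  shows "\<nu> k < 1"
proof -
  note eS = eigenvector_in(2)[OF k]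
  note Pe = za.proj_in[OF eS]
  have hardy: "e k \<in> hardy_space" "za.proj (e k) \<in> hardy_space"
    using eigenvector_hardy[OF k] za.kernel_span_hardy[OF Pe(3)] by auto
  define d where "d = e k - za.proj (e k)"
  have dH: "d \<in> hardy_space"
    unfolding d_def by (rule cfun.subspace_diff[OF hardy_space_subspace hardy])
  have one: "hardy_inner (e k) (e k) = 1" using e k by (simp add: orthonormal_def)
  have "hardy_inner d d = hardy_inner d (e k)"
    using hardy_inner_diff_right[OF hardy dH] za.inner_vanishing(2)[OF Pe(1) Pe(2)]
    by (simp add: d_def)
  also have "\<dots> = of_real (1 - \<nu> k)"
    unfolding d_def using hardy_inner_diff_left[OF hardy hardy(1)] inner_proj_eigenvector[OF k k] one
    by simp
  finally have dd: "hardy_inner d d = of_real (1 - \<nu> k)" .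
  then have "0 \<le> 1 - \<nu> k" using hardy_inner_self_nonneg(2)[OF dH] by simp
  moreover have "\<nu> k \<noteq> 1"
  proof
    assume "\<nu> k = 1"
    then have "d = 0" using dd hardy_inner_eq_0[OF dH] by simp
    then have "e k = za.proj (e k)" unfolding d_def by simp
    then have "e k \<in> vanishing_subspace (A \<union> B) A" using Pe(1) by simp
    then have "e k = 0"
      using kernel_span_vanishing_imp_zero[OF finite disk _ eigenvector_in(1)[OF k]] card
      by (simp add: vanishing_subspace_def)
    then show False using one hardy_inner_zero_left by simp
  qed
  ultimately show ?thesis by simp
qed

text \<open>Apply \<open>za.proj\<close> to
  \<open>zb.proj (za.proj (e k)) = za.proj (e k) - compression (e k)\<close>.\<close>

lemma proj_proj_eigenvector:
  assumes k: "k < n"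
  shows "za.proj (zb.proj (za.proj (e k))) = (\<lambda>z. complex_of_real (1 - \<nu> k) * za.proj (e k) z)"
proof -
  note eS = eigenvector_in(2)[OF k]
  note Pe = za.proj_in[OF eS]
  have eq: "zb.proj (za.proj (e k)) = za.proj (e k) - compression (e k)"
    by (simp add: compression_def fun_eq_iff)
  have cS: "compression (e k) \<in> kernel_span (A \<union> B)"
    by (rule zb.kernel_span_A[OF compression_in[OF eS]])
  show ?thesis
    unfolding eq za.proj_diff[OF Pe(3) cS] za.proj_vanishing[OF Pe(1)]
    unfolding eigen[OF k] za.proj_scale[OF eS]
    by (simp add: fun_eq_iff left_diff_distrib)
qed

context
  assumes pos: "\<And>k. k < n \<Longrightarrow> 0 < \<nu> k"
begin

text \<open>The scalar normalizes: the squared norm of \<open>zb.proj (za.proj (e k))\<close> is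
  \<open>\<nu> k * (1 - \<nu> k)\<close>, by \<open>proj_proj_eigenvector\<close> and
  \<open>inner_proj_eigenvector\<close>.\<close>

definition transported :: "nat \<Rightarrow> complex \<Rightarrow> complex" where
  "transported k = (\<lambda>z. complex_of_real (1 / sqrt (\<nu> k * (1 - \<nu> k))) * zb.proj (za.proj (e k)) z)"

lemma transported_in:
  assumes "k < n"
  shows "zb.proj (za.proj (e k)) \<in> Zb" "transported k \<in> Zb" "transported k \<in> hardy_space"
proof -
  show *: "zb.proj (za.proj (e k)) \<in> Zb"
    by (intro zb.proj_in(1) za.proj_in(3) eigenvector_in(2) assms)
  then show **: "transported k \<in> Zb"
    unfolding transported_def by (rule cfun.subspace_scale[OF zb.subspace_vanishing])
  then show "transported k \<in> hardy_space"
    by (intro zb.kernel_span_hardy zb.vanishing_kernel_span)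
qed

lemma inner_transported:
  assumes g: "g \<in> Zb" and k: "k < n"
  shows "hardy_inner g (transported k) =
    of_real (1 / sqrt (\<nu> k * (1 - \<nu> k))) * hardy_inner g (za.proj (e k))"
proof -
  have gH: "g \<in> hardy_space" using g by (intro zb.kernel_span_hardy zb.vanishing_kernel_span)
  have "hardy_inner g (transported k) =
      cnj (of_real (1 / sqrt (\<nu> k * (1 - \<nu> k)))) * hardy_inner g (zb.proj (za.proj (e k)))"
    unfolding transported_def
    by (rule hardy_inner_scale_right[OF _ gH])
       (intro zb.kernel_span_hardy zb.vanishing_kernel_span transported_in(1) k)
  then show ?thesis
    unfolding zb.proj_inner(2)[OF za.proj_in(3)[OF eigenvector_in(2)[OF k]] g] by simp
qed

text \<open>Moving both projections across the inner product produces
  \<open>za.proj (zb.proj (za.proj (e k)))\<close>, to which \<open>proj_proj_eigenvector\<close>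
  applies.\<close>

lemma inner_adjoint_transported:
  assumes g: "g \<in> Zb" and k: "k < n"
  shows "hardy_inner (zb.proj (za.proj g)) (transported k) =
    complex_of_real (1 - \<nu> k) * hardy_inner g (transported k)"
proof -
  define c where "c = complex_of_real (1 / sqrt (\<nu> k * (1 - \<nu> k)))"
  note gS = zb.vanishing_kernel_span[OF g]
  note Pg = za.proj_in[OF gS]
  note eS = eigenvector_in(2)[OF k]
  note Pe = za.proj_in[OF eS]
  note QPe = zb.proj_in[OF Pe(3)]
  have "hardy_inner (zb.proj (za.proj g)) (transported k) =
      c * hardy_inner (zb.proj (za.proj g)) (za.proj (e k))"
    unfolding c_def by (rule inner_transported[OF zb.proj_in(1)[OF Pg(3)] k])
  also have "hardy_inner (zb.proj (za.proj g)) (za.proj (e k)) = hardy_inner g (za.proj (zb.proj (za.proj (e k))))"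
    unfolding zb.proj_self_adjoint[OF Pg(3) Pe(3)] za.proj_self_adjoint[OF gS QPe(3)] ..
  also have "\<dots> = of_real (1 - \<nu> k) * hardy_inner g (za.proj (e k))"
    unfolding proj_proj_eigenvector[OF k]
    using hardy_inner_scale_right[OF za.kernel_span_hardy[OF Pe(3)] za.kernel_span_hardy[OF gS]] by simp
  finally show ?thesis unfolding inner_transported[OF g k] c_def by simp
qed

lemma orthonormal_transported: "orthonormal n transported"
  unfolding orthonormal_def
proof (intro conjI allI impI)
  fix k l assume k: "k < n" and l: "l < n"
  define r where "r k = \<nu> k * (1 - \<nu> k)" for k
  have r: "0 < r k" if "k < n" for k using pos eigenvalue_less_1 that by (simp add: r_def)
  note Pk = za.proj_in[OF eigenvector_in(2)[OF k]]
  note Pl = za.proj_in[OF eigenvector_in(2)[OF l]]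
  note QPk = zb.proj_in[OF Pk(3)]
  have "hardy_inner (transported k) (transported l) =
      of_real (1 / sqrt (r l)) * hardy_inner (transported k) (za.proj (e l))"
    unfolding r_def by (rule inner_transported[OF transported_in(2)[OF k] l])
  also have "hardy_inner (transported k) (za.proj (e l)) =
      of_real (1 / sqrt (r k)) * hardy_inner (zb.proj (za.proj (e k))) (za.proj (e l))"
    unfolding transported_def r_def
    by (rule hardy_inner_scale_left[OF zb.kernel_span_hardy[OF QPk(3)] za.kernel_span_hardy[OF Pl(3)]])
  also have "hardy_inner (zb.proj (za.proj (e k))) (za.proj (e l)) =
      hardy_inner (za.proj (zb.proj (za.proj (e k)))) (e l)"
    by (rule za.proj_self_adjoint[symmetric, OF QPk(3) eigenvector_in(2)[OF l]])
  also have "\<dots> = of_real (1 - \<nu> k) * hardy_inner (za.proj (e k)) (e l)"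
    unfolding proj_proj_eigenvector[OF k]
    by (rule hardy_inner_scale_left[OF za.kernel_span_hardy[OF Pk(3)] eigenvector_hardy[OF l]])
  also have "\<dots> = (if k = l then complex_of_real (r k) else 0)"
    unfolding inner_proj_eigenvector[OF k l] by (simp add: r_def mult.commute)
  finally have eq: "hardy_inner (transported k) (transported l) =
     of_real (1 / sqrt (r l)) * (of_real (1 / sqrt (r k)) * (if k = l then of_real (r k) else 0))" .
  show "hardy_inner (transported k) (transported l) = (if k = l then 1 else 0)"
  proof (cases "k = l")
    case True
    have "1 / sqrt (r k) * (1 / sqrt (r k) * r k) = 1"
      using r[OF k] real_sqrt_mult_self[of "r k"] by (simp add: divide_simps)
    then show ?thesis
      unfolding eq using True by (simp del: of_real_divide of_real_mult flip: of_real_mult)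
  qed (simp add: eq)
qed (rule transported_in)

text \<open>If \<open>g\<close> in \<open>Zb\<close> is orthogonal to the family, its compression is
  orthogonal to every \<open>e k\<close> and so is zero. Then \<open>za.proj g\<close> vanishes on
  both sets, hence is zero, and \<open>g\<close> lies in the span of the kernels at \<open>A\<close>
  while vanishing on \<open>B\<close>.\<close>

lemma span_transported: "Zb = cfun.span (transported ` {..<n})"
proof (rule orthonormal_spanI[OF orthonormal_transported zb.subspace_vanishing])
  show "Zb \<subseteq> hardy_space" using zb.kernel_span_hardy zb.vanishing_kernel_span by blast
  show "transported ` {..<n} \<subseteq> Zb" using transported_in by auto
  fix g assume g: "g \<in> Zb" and orth: "\<And>k. k < n \<Longrightarrow> hardy_inner g (transported k) = 0"
  note gS = zb.vanishing_kernel_span[OF g]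
  note Pg = za.proj_in[OF gS]
  have "hardy_inner (compression g) (e k) = hardy_inner 0 (e k)" if k: "k < n" for k
  proof -
    have "hardy_inner g (za.proj (e k)) = 0"
      using orth[OF k] pos[OF k] eigenvalue_less_1[OF k] unfolding inner_transported[OF g k] by simp
    then show ?thesis
      unfolding compression_inner(1)[OF gS eigenvector_in(1)[OF k]]
        za.proj_self_adjoint[OF gS eigenvector_in(2)[OF k]] by (simp add: hardy_inner_zero_left)
  qed
  then have "compression g = 0"
    using compression_in[OF gS] cfun.span_zero unfolding span by (intro orthonormal_eqI[OF e])
  then have "za.proj g = zb.proj (za.proj g)" unfolding compression_def by simp
  then have "za.proj g \<in> Zb" using zb.proj_in(1)[OF Pg(3)] by simp
  then have "za.proj g z = 0" if "z \<in> A \<union> B" for z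
    using Pg(1) that by (auto simp: vanishing_subspace_def)
  then have "hardy_inner (za.proj g) (za.proj g) = 0"
    using hardy_inner_kernel_span_vanishing(1)[OF za.disk za.kernel_span_hardy[OF Pg(3)] _ Pg(3)] by blast
  then have "za.proj g = 0" by (rule hardy_inner_eq_0[OF za.kernel_span_hardy[OF Pg(3)]])
  then have "g \<in> kernel_span A" using Pg(2) by simp
  then show "g = 0"
    using kernel_span_vanishing_imp_zero[OF finite(2,1) disk(2,1)] card g
    by (simp add: vanishing_subspace_def)
qed

lemma singular_value_eq:
  assumes "\<And>i j. i \<le> j \<Longrightarrow> j < n \<Longrightarrow> \<nu> j \<le> \<nu> i" "k < n"
  shows "singular_value Zb (\<lambda>f. za.proj (zb.proj f)) k = sqrt (1 - \<nu> (n - 1 - k))"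
proof (rule singular_value_eigenbasis[OF orthonormal_transported span_transported])
  fix g assume g: "g \<in> Zb"
  note Pg = za.proj_in[OF zb.vanishing_kernel_span[OF g]]
  show "hardy_adjoint Zb (\<lambda>f. za.proj (zb.proj f)) (za.proj (zb.proj g)) \<in> Zb"
    unfolding hardy_adjoint_proj[OF g] by (rule zb.proj_in(1)[OF Pg(3)])
  show "hardy_inner (hardy_adjoint Zb (\<lambda>f. za.proj (zb.proj f)) (za.proj (zb.proj g))) (transported k) =
      of_real (1 - \<nu> k) * hardy_inner g (transported k)" if "k < n" for k
    unfolding hardy_adjoint_proj[OF g] by (rule inner_adjoint_transported[OF g that])
qed (use assms eigenvalue_less_1 in \<open>auto intro: less_imp_le\<close>)

end

end

end

section \<open>Gram matrices of kernels, and the conclusion\<close>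

text \<open>A null vector gives a combination of kernels orthogonal to each of them, hence zero;
  independence makes the vector zero.\<close>

lemma det_szego_gram_nonzero:
  assumes "inj_on w {..<m}" "w ` {..<m} \<subseteq> ball 0 1"
  shows "det (mat m m (\<lambda>(i, j). hardy_inner (szego_kernel (w i)) (szego_kernel (w j)))) \<noteq> 0"
    (is "det ?G \<noteq> 0")
proof
  assume "det ?G = 0"
  then obtain v where v: "v \<in> carrier_vec m" "v \<noteq> 0\<^sub>v m" "?G *\<^sub>v v = 0\<^sub>v m"
    using det_0_iff_vec_prod_zero[of ?G m] by auto
  define k where "k i = szego_kernel (w i)" for i
  have kH: "k i \<in> hardy_space" if "i < m" for i
    unfolding k_def using assms(2) that by (intro szego_kernel_in_hardy_space) auto
  \<comment> \<open>With conjugated coefficients, entry \<open>i\<close> of the matrix applied to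
    \<open>v\<close> is \<open>hardy_inner (k i) f\<close>.\<close>
  define f where "f = (\<Sum>j<m. (\<lambda>z. cnj (v $ j) * k j z))"
  have fH: "f \<in> hardy_space"
    unfolding f_def using kH by (intro cfun.subspace_sum cfun.subspace_scale hardy_space_subspace) auto
  have ind: "cfun.independent (k ` {..<m})" "inj_on k {..<m}"
  proof -
    show "cfun.independent (k ` {..<m})"
      using szego_kernels_independent(1)[of "w ` {..<m}"] assms(2) by (simp add: k_def image_image)
    show "inj_on k {..<m}"
      using comp_inj_on[OF assms(1) szego_kernels_independent(2)[of "w ` {..<m}"]] assms(2)
      by (simp add: inj_on_def k_def)
  qed
  have "hardy_inner f (k i) = 0" if i: "i < m" for i
  proof -
    have "hardy_inner f (k i) = (\<Sum>j<m. cnj (v $ j) * hardy_inner (k j) (k i))"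
      unfolding f_def by (rule hardy_inner_sum_left) (use kH i in auto)
    also have "\<dots> = cnj (\<Sum>j<m. hardy_inner (k i) (k j) * v $ j)"
      using kH i by (auto simp: hardy_inner_commute[of "k i"] mult.commute intro!: sum.cong)
    also have "(\<Sum>j<m. hardy_inner (k i) (k j) * v $ j) = (?G *\<^sub>v v) $ i"
      using i v(1) by (simp add: scalar_prod_def k_def atLeast0LessThan)
    finally show ?thesis using v(3) i by simp
  qed
  then have "hardy_inner f g = 0" if "g \<in> k ` {..<m}" for g using that by auto
  moreover have "f \<in> cfun.span (k ` {..<m})"
    unfolding f_def by (intro cfun.span_sum cfun.span_scale cfun.span_base) auto
  ultimately have "hardy_inner f f = 0"
    using hardy_orthogonal_complement_span[of "k ` {..<m}" f f] kH fH by auto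
  then have f0: "f = 0" by (rule hardy_inner_eq_0[OF fH])
  have "v $ j = 0" if j: "j < m" for j
  proof -
    \<comment> \<open>Independence of a set takes coefficients indexed by the functions
      themselves.\<close>
    define u where "u h = cnj (v $ the_inv_into {..<m} k h)" for h
    have "(\<Sum>h\<in>k ` {..<m}. (\<lambda>z. u h * h z)) = f"
      unfolding f_def sum.reindex[OF ind(2)] o_def u_def
      by (intro sum.cong refl) (simp add: the_inv_into_f_f[OF ind(2)])
    then have "u (k j) = 0"
      using cfun.independentD[OF ind(1), of "k ` {..<m}" u "k j"] j f0 by auto
    then show ?thesis using j by (simp add: u_def the_inv_into_f_f[OF ind(2)])
  qed
  then have "v = 0\<^sub>v m" using v(1) by (intro eq_vecI) auto
  then show False using v(2) by simp
qed

lemma sqrt_prod: "sqrt (prod f S) = (\<Prod>i\<in>S. sqrt (f i))"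
  by (induction S rule: infinite_finite_induct) (simp_all add: real_sqrt_mult)

theorem corollary4p14:
  fixes n :: nat and a b :: "nat \<Rightarrow> complex"
  defines "A \<equiv> a ` {1..n}" and "B \<equiv> b ` {1..n}"
  defines "Za \<equiv> vanishing_subspace (A \<union> B) A" and "Zb \<equiv> vanishing_subspace (A \<union> B) B"
  defines "s \<equiv> singular_value Zb (\<lambda>f. orth_proj Za (orth_proj Zb f))"
  assumes "n \<ge> 1"
    and "inj_on a {1..n}" and "inj_on b {1..n}"
    and "A \<subseteq> ball 0 1" and "B \<subseteq> ball 0 1" and "A \<inter> B = {}"
    and "\<And>i j. 1 \<le> i \<Longrightarrow> i \<le> j \<Longrightarrow> j \<le> n \<Longrightarrow>
           cmod (blaschke_product A (b j)) \<le> cmod (blaschke_product A (b i))"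
  shows "((\<forall>m\<in>{1..n}. (\<Prod>j=1..m. cmod (blaschke_product A (b j)))
                       \<le> (\<Prod>j=1..m. sqrt (1 - (s (n - j))\<^sup>2))) \<and>
          (\<Prod>j=1..n. cmod (blaschke_product A (b j)))
                       = (\<Prod>j=1..n. sqrt (1 - (s (n - j))\<^sup>2))) \<and>
         (\<forall>m\<in>{1..n}. (\<Sum>j=1..m. cmod (blaschke_product A (b j)))
                       \<le> (\<Sum>j=1..m. sqrt (1 - (s (n - j))\<^sup>2)))"
proof -
  have "card A = n" "card B = n"
    using card_image[OF assms(7)] card_image[OF assms(8)] by (simp_all add: A_def B_def)
  then interpret kernel_pair A B
    by unfold_locales (use assms(9,10) in \<open>auto simp: A_def B_def\<close>)
  have fin: "finite (szego_kernel ` B)" using finite by simp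
  have sub: "kernel_span B \<subseteq> cfun.span (szego_kernel ` B)" by (simp add: kernel_span_def)
  obtain n' e \<nu> where e: "orthonormal n' e" and span: "kernel_span B = cfun.span (e ` {..<n'})"
    and eigen: "\<And>k. k < n' \<Longrightarrow> compression (e k) = (\<lambda>z. complex_of_real (\<nu> k) * e k z)"
    and anti': "\<And>i j. i \<le> j \<Longrightarrow> j < n' \<Longrightarrow> \<nu> j \<le> \<nu> i"
    by (rule hardy_spectral_theorem_sorted[OF compression_endomorphism
          kernel_span_subset_hardy_space[OF disk(2)] fin sub],
        erule (1) compression_self_adjoint, rule that)
  \<comment> \<open>The eigenvectors and the kernels are two bases of the same space.\<close>
  have "n' = cfun.dim (kernel_span B)"
    unfolding span using orthonormal_independent[OF e, of "{..<n'}"]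
    by (subst cfun.dim_span_eq_card_independent) (simp_all add: card_image)
  also have "\<dots> = n"
    unfolding kernel_span_def using szego_kernels_independent[OF finite(2) disk(2)] \<open>card B = n\<close>
    by (subst cfun.dim_span_eq_card_independent) (simp_all add: card_image)
  finally have n': "n' = n" .
  note e = e[unfolded n'] and span = span[unfolded n'] and eigen = eigen[unfolded n']
    and anti = anti'[unfolded n']
  \<comment> \<open>The points are renumbered from \<open>0\<close>; \<open>x\<close> holds the
    coordinates of the kernels in the eigenbasis.\<close>
  define w where "w i = b (Suc i)" for i
  define l where "l i = blaschke_product A (w i)" for i
  define k where "k i = szego_kernel (w i)" for i
  define x where "x i j = hardy_inner (k i) (e j)" for i j
  have wB: "w i \<in> B" if "i < n" for i using that by (auto simp: w_def B_def)
  have wD: "w i \<in> ball 0 1" if "i < n" for i using wB[OF that] disk(2) by auto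
  have kB: "k i \<in> kernel_span B" if "i < n" for i
    unfolding k_def by (rule szego_kernel_in_kernel_span[OF wB[OF that]])
  have kH: "k i \<in> hardy_space" if "i < n" for i
    unfolding k_def by (rule szego_kernel_in_hardy_space[OF wD[OF that]])
  have winj: "inj_on w {..<n}"
  proof (rule inj_onI)
    fix i j assume "i \<in> {..<n}" "j \<in> {..<n}" "w i = w j"
    then show "i = j" using inj_onD[OF assms(8), of "Suc i" "Suc j"] by (simp add: w_def)
  qed
  have gram: "hardy_inner (k i) (k j) = (\<Sum>q<n. x i q * cnj (x j q))" if "i < n" "j < n" for i j
    unfolding x_def by (rule orthonormal_parseval[OF e kB[OF that(1), unfolded span] kH[OF that(2)]])
  \<comment> \<open>Both sides equal \<open>hardy_inner (za.proj (k i)) (k j)\<close>: the left by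
    Parseval in the eigenbasis, the right by evaluating the explicit projection of
    \<open>k i\<close> at \<open>w j\<close>.\<close>
  have gram_weighted: "(\<Sum>q<n. \<nu> q * x i q * cnj (x j q)) = cnj (l i) * l j * hardy_inner (k i) (k j)"
    if i: "i < n" and j: "j < n" for i j
  proof -
    have kS: "k i \<in> kernel_span (A \<union> B)" by (rule zb.kernel_span_A[OF kB[OF i]])
    have "hardy_inner (compression (k i)) (e q) = of_real (\<nu> q) * x i q" if q: "q < n" for q
    proof -
      have eq: "e q \<in> kernel_span B" "e q \<in> hardy_space"
        using q e unfolding span by (auto intro: cfun.span_base simp: orthonormal_def)
      have "hardy_inner (compression (k i)) (e q) = hardy_inner (k i) (compression (e q))"
        by (rule compression_self_adjoint[OF kB[OF i] eq(1)])
      then show ?thesis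
        unfolding eigen[OF q] hardy_inner_scale_right[OF eq(2) kH[OF i]] x_def by simp
    qed
    then have "(\<Sum>q<n. \<nu> q * x i q * cnj (x j q)) =
        (\<Sum>q<n. hardy_inner (compression (k i)) (e q) * cnj (hardy_inner (k j) (e q)))"
      by (intro sum.cong) (simp_all add: x_def)
    also have "\<dots> = hardy_inner (compression (k i)) (k j)"
      by (rule orthonormal_parseval[symmetric, OF e compression_in[OF kS, unfolded span] kH[OF j]])
    also have "\<dots> = hardy_inner (za.proj (k i)) (k j)"
      by (rule compression_inner(1)[OF kS kB[OF j]])
    also have "\<dots> = za.proj (k i) (w j)"
      unfolding k_def[of j]
      by (rule szego_kernel_reproducing[OF za.kernel_span_hardy[OF za.proj_in(3)[OF kS]] wD[OF j]])
    also have "\<dots> = cnj (l i) * (l j * k i (w j))"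
      unfolding k_def l_def using za.proj_szego_kernel[of "w i" "w j"] wB[OF i] by simp
    also have "k i (w j) = hardy_inner (k i) (k j)"
      unfolding k_def[of j] by (rule szego_kernel_reproducing[OF kH[OF i] wD[OF j], symmetric])
    finally show ?thesis by (simp add: mult.assoc)
  qed
  \<comment> \<open>The eigenvalue is the squared norm of \<open>za.proj (e q)\<close>.\<close>
  have nonneg: "0 \<le> \<nu> q" if "q < n" for q
  proof -
    have eS: "e q \<in> kernel_span (A \<union> B)"
      using that unfolding span by (intro zb.kernel_span_A) (auto simp: span intro: cfun.span_base)
    note Pe = za.proj_in[OF eS]
    have "hardy_inner (za.proj (e q)) (za.proj (e q)) = hardy_inner (za.proj (e q)) (e q)"
      by (rule za.proj_inner(2)[OF eS Pe(1)])
    then have "hardy_inner (za.proj (e q)) (za.proj (e q)) = of_real (\<nu> q)"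
      using inner_proj_eigenvector[OF e span eigen that that] by simp
    then show ?thesis using hardy_inner_self_nonneg(2)[OF za.kernel_span_hardy[OF Pe(3)]] by simp
  qed
  have det: "det (mat m m (\<lambda>(i, j). \<Sum>q<n. x i q * cnj (x j q))) \<noteq> 0" if "m \<le> n" for m
  proof -
    have "mat m m (\<lambda>(i, j). \<Sum>q<n. x i q * cnj (x j q)) =
        mat m m (\<lambda>(i, j). hardy_inner (szego_kernel (w i)) (szego_kernel (w j)))"
      using that gram by (intro cong_mat) (auto simp: k_def)
    moreover have "w ` {..<m} \<subseteq> ball 0 1"
      using wD that by (auto simp del: mem_ball)
    ultimately show ?thesis
      using det_szego_gram_nonzero[of w m] inj_on_subset[OF winj, of "{..<m}"] that by auto
  qed
  have weyl: "(\<Prod>i<m. (cmod (l i))\<^sup>2) \<le> (\<Prod>i<m. \<nu> i)"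
    "m = n \<Longrightarrow> (\<Prod>i<m. (cmod (l i))\<^sup>2) = (\<Prod>i<m. \<nu> i)" if "m \<le> n" for m
    using weyl_product[of n \<nu> m x l, OF anti nonneg _ det[OF that]] gram_weighted gram that by auto
  \<comment> \<open>Disjointness enters here: \<open>B\<^sub>A\<close> has no zero in
    \<open>B\<close>.\<close>
  have lpos: "0 < cmod (l i)" if "i < n" for i
    using blaschke_product_eq_0_iff[OF finite(1) disk(1) wD[OF that]] wB[OF that] assms(11)
    by (auto simp: l_def)
  \<comment> \<open>Equality at \<open>m = n\<close> excludes a zero eigenvalue, as the
    normalization of \<open>transported\<close> and the logarithms demand.\<close>
  have "(\<Prod>i<n. \<nu> i) \<noteq> 0" using weyl(2)[of n] lpos by (auto simp flip: weyl(2))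
  then have pos: "0 < \<nu> q" if "q < n" for q using nonneg[OF that] that by (force simp: less_le)
  \<comment> \<open>The smallest singular values belong to the largest eigenvalues;
    \<open>Suc i\<close> is the index \<open>j\<close> of the theorem.\<close>
  have s: "sqrt (1 - (s (n - Suc i))\<^sup>2) = sqrt (\<nu> i)" if "i < n" for i
  proof -
    have "s (n - Suc i) = sqrt (1 - \<nu> (n - 1 - (n - Suc i)))"
      unfolding s_def Za_def Zb_def
      by (rule singular_value_eq[OF e span eigen pos anti]) (use that in auto)
    also have "n - 1 - (n - Suc i) = i" using that by simp
    finally show ?thesis using eigenvalue_less_1[OF e span eigen that] by simp
  qed
  have prod_sq: "(\<Prod>i<m. cmod (l i)) = sqrt (\<Prod>i<m. (cmod (l i))\<^sup>2)" for m
    by (simp add: sqrt_prod)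
  have prod: "(\<Prod>i<m. cmod (l i)) \<le> (\<Prod>i<m. sqrt (\<nu> i))"
    "m = n \<Longrightarrow> (\<Prod>i<m. cmod (l i)) = (\<Prod>i<m. sqrt (\<nu> i))" if "m \<le> n" for m
    unfolding prod_sq sqrt_prod[symmetric] using weyl[OF that] by simp_all
  \<comment> \<open>The product inequalities for all initial segments imply this, given the assumed
    order of the points.\<close>
  have "(\<Sum>i<m. cmod (l i)) \<le> (\<Sum>i<m. sqrt (\<nu> i))" if "m \<le> n" for m
  proof (rule sum_le_of_prod_le)
    show "cmod (l j) \<le> cmod (l i)" if "i \<le> j" "j < m" for i j
      using assms(12)[of "Suc i" "Suc j"] that \<open>m \<le> n\<close> by (simp add: l_def w_def)
  qed (use that lpos pos prod(1) in auto)
  with prod show ?thesis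
    using s by (simp add: prod.atLeast1_atMost_eq sum.atLeast1_atMost_eq l_def w_def)
qed

end
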